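(* Let $n,m,N$ be positive integers, $p_1,\ldots,p_N,q_1,\ldots,q_N,g_1,\ldots,g_m\in\mathbb{R}[\mathbf{x}]$ with $\mathbf{x}=(x_1,\ldots,x_n)$, $\mathbf{K}=\{\mathbf{x}\mid g_j(\mathbf{x})\ge0,\ j\in[m]\}$ compact with $q_i>0$ on $\mathbf{K}$ for all $i$, and $\rho=\inf_{\mathbf{x}\in\mathbf{K}}\sum_ip_i/q_i$. Suppose $I_1,\ldots,I_N\subseteq[n]$, $J_1,\ldots,J_N\subseteq[m]$ satisfy $[n]=\bigcup I_i$, $[m]=\bigcup J_i$ and: (i) $p_i,q_i\in\mathbb{R}[\mathbf{x}(I_i)]$; (ii) $g_j\in\mathbb{R}[\mathbf{x}(I_i)]$ for $j\in J_i$; (iii) for each $i$ some $k\in J_i$ has $g_k=M_i-\sum_{\ell\in I_i}x_\ell^2$ with $M_i>0$; (iv) for each $i\ge2$, $I_i\cap\bigcup_{j<i}I_j\subseteq I_k$ for some $k<i$. Assume $q_i>0$ on $\mathbf{K}_i=\{\mathbf{z}\in\mathbb{R}^{I_i}\mid g_j(\mathbf{z})\ge0,\ j\in J_i\}$ for all $i$. Then $\rho^{\mathrm{cs}}_k=\rho^{\mathrm{c}}_k$ for all integers $k\ge d_{\min}$, and consequently $\rho^{\mathrm{cs}}_k$ is nondecreasing in $k$ and converges to $\rho$ as $k\to\infty$.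
   Context: $\mathbf{x}(I)=\{x_\ell\mid\ell\in I\}$. $d_j=\lceil\deg g_j/2\rceil$, $d_{\min}=\max\{\lceil\deg p_i/2\rceil,\lceil\deg q_i/2\rceil\ (i\in[N]);d_j\ (j\in[m])\}$. For a sequence $\mathbf{y}=(y_{\boldsymbol{\alpha}})$, $L_{\mathbf{y}}(\sum f_{\boldsymbol{\alpha}}\mathbf{x}^{\boldsymbol{\alpha}})=\sum f_{\boldsymbol{\alpha}}y_{\boldsymbol{\alpha}}$; $\mathbf{M}_k(\mathbf{y})$ has $(\boldsymbol{\alpha},\boldsymbol{\beta})$ entry $y_{\boldsymbol{\alpha}+\boldsymbol{\beta}}$ ($|\boldsymbol{\alpha}|,|\boldsymbol{\beta}|\le k$), and for $f=\sum f_{\boldsymbol{\gamma}}\mathbf{x}^{\boldsymbol{\gamma}}$, $\mathbf{M}_k(f\mathbf{y})$ has entry $\sum_{\boldsymbol{\gamma}}f_{\boldsymbol{\gamma}}y_{\boldsymbol{\gamma}+\boldsymbol{\alpha}+\boldsymbol{\beta}}$. $\mathbf{M}_k(\mathbf{y},I)$, $\mathbf{M}_k(f\mathbf{y},I)$ are principal submatrices indexed by $\boldsymbol{\alpha}$ with $\alpha_\ell=0$ for $\ell\notin I$. $U_i=\{j>i\mid I_i\cap I_j\ne\emptyset\}$. $\mathbb{N}^{(ij)}_s=\{\boldsymbol{\alpha}\in\mathbb{N}^n:|\boldsymbol{\alpha}|\le s,\ \alpha_\ell=0\ \forall\ell\notin I_i\cap I_j\}$. Let $\mathcal{A}=\bigcup_i(\operatorname{supp}p_i\cup\operatorname{supp}q_i)\cup\bigcup_j\operatorname{supp}g_j$,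 $\mathcal{R}=\{\mathbf{r}\in\{0,1\}^n\mid\mathbf{r}^\intercal\boldsymbol{\alpha}\equiv0\ (\mathrm{mod}\,2)\ \forall\boldsymbol{\alpha}\in\mathcal{A}\}$, $\overline{\mathcal{A}}=\{\boldsymbol{\alpha}\in\mathbb{N}^n\mid\mathbf{r}^\intercal\boldsymbol{\alpha}\equiv0\ (\mathrm{mod}\,2)\ \forall\mathbf{r}\in\mathcal{R}\}$. $B^{\mathcal{A}}_{i,s}$ is the $0/1$ matrix indexed by $\{\boldsymbol{\alpha}\in\mathbb{N}^n:|\boldsymbol{\alpha}|\le s,\ \alpha_\ell=0\ \forall\ell\notin I_i\}$ with entry $1$ iff $\boldsymbol{\alpha}+\boldsymbol{\beta}\in\overline{\mathcal{A}}$; $\circ$ is the Hadamard product. $\rho^{\mathrm{c}}_k$ is the infimum of $\sum_iL_{\mathbf{y}_i}(p_i)$ over sequences $\mathbf{y}_i$ (indexed by $\boldsymbol{\alpha}$ with $|\boldsymbol{\alpha}|\le2k$, $\alpha_\ell=0$ for $\ell\notin I_i$) subject to $\mathbf{M}_k(\mathbf{y}_i,I_i)\succeq0$, $\mathbf{M}_{k-d_j}(g_j\mathbf{y}_i,I_i)\succeq0$ ($j\in J_i$), $L_{\mathbf{y}_i}(q_i)=1$ ($i\in[N]$), and $L_{\mathbf{y}_i}(\mathbf{x}^{\boldsymbol{\alpha}}q_i)=L_{\mathbf{y}_j}(\mathbf{x}^{\boldsymbol{\alpha}}q_j)$ for all $\boldsymbol{\alpha}\in\mathbb{N}^{(ij)}_{2k-\max\{\deg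 q_i,\deg q_j\}}$, $j\in U_i$, $i\in[N-1]$. $\rho^{\mathrm{cs}}_k$ is defined identically except that the positivity constraints are $B^{\mathcal{A}}_{i,k}\circ\mathbf{M}_k(\mathbf{y}_i,I_i)\succeq0$ and $B^{\mathcal{A}}_{i,k-d_j}\circ\mathbf{M}_{k-d_j}(g_j\mathbf{y}_i,I_i)\succeq0$, and the linking equalities are imposed only for $\boldsymbol{\alpha}\in\mathbb{N}^{(ij)}_{2k-\max\{\deg q_i,\deg q_j\}}\cap\overline{\mathcal{A}}$. *)

theory Defs
  imports "HOL-Analysis.Analysis" "HOL-Library.Poly_Mapping" "HOL-Library.Extended_Real"
begin

text \<open>Multivariate real polynomials: finitely supported maps from monomials
  (exponent vectors, finitely supported maps nat to nat) to real coefficients.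
  Variable x_l is indexed by the natural number l; the ambient variables are x_1..x_n.\<close>

type_synonym monomial = "nat \<Rightarrow>\<^sub>0 nat"
type_synonym rpoly = "monomial \<Rightarrow>\<^sub>0 real"

definition mdeg :: "monomial \<Rightarrow> nat" where
  "mdeg a = (\<Sum>l\<in>Poly_Mapping.keys a. Poly_Mapping.lookup a l)"

definition pdeg :: "rpoly \<Rightarrow> nat" where
  "pdeg p = Max (insert 0 (mdeg ` Poly_Mapping.keys p))"

definition peval :: "rpoly \<Rightarrow> (nat \<Rightarrow> real) \<Rightarrow> real" where
  "peval p x = (\<Sum>a\<in>Poly_Mapping.keys p. Poly_Mapping.lookup p a * (\<Prod>l\<in>Poly_Mapping.keys a. x l ^ Poly_Mapping.lookup a l))"

definition vars_in :: "nat set \<Rightarrow> rpoly \<Rightarrow> bool" where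
  "vars_in S p \<longleftrightarrow> (\<forall>a\<in>Poly_Mapping.keys p. Poly_Mapping.keys a \<subseteq> S)"

definition xmon :: "monomial \<Rightarrow> rpoly" where
  "xmon a = Poly_Mapping.single a 1"

definition Ly :: "(monomial \<Rightarrow> real) \<Rightarrow> rpoly \<Rightarrow> real" where
  "Ly y f = (\<Sum>a\<in>Poly_Mapping.keys f. Poly_Mapping.lookup f a * y a)"

definition mons :: "nat set \<Rightarrow> nat \<Rightarrow> monomial set" where
  "mons I s = {a. mdeg a \<le> s \<and> Poly_Mapping.keys a \<subseteq> I}"

definition mom :: "(monomial \<Rightarrow> real) \<Rightarrow> monomial \<Rightarrow> monomial \<Rightarrow> real" where
  "mom y a b = y (a + b)"

definition locm :: "rpoly \<Rightarrow> (monomial \<Rightarrow> real) \<Rightarrow> monomial \<Rightarrow> monomial \<Rightarrow> real" where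
  "locm f y a b = (\<Sum>c\<in>Poly_Mapping.keys f. Poly_Mapping.lookup f c * y (c + a + b))"

definition psd_on :: "monomial set \<Rightarrow> (monomial \<Rightarrow> monomial \<Rightarrow> real) \<Rightarrow> bool" where
  "psd_on S M \<longleftrightarrow> (\<forall>v. 0 \<le> (\<Sum>a\<in>S. \<Sum>b\<in>S. v a * M a b * v b))"

definition hadB :: "monomial set \<Rightarrow> (monomial \<Rightarrow> monomial \<Rightarrow> real) \<Rightarrow> monomial \<Rightarrow> monomial \<Rightarrow> real" where
  "hadB Abar M a b = (if a + b \<in> Abar then 1 else 0) * M a b"

definition dhalf :: "rpoly \<Rightarrow> nat" where
  "dhalf f = (pdeg f + 1) div 2"

definition dmin :: "nat \<Rightarrow> nat \<Rightarrow> (nat \<Rightarrow> rpoly) \<Rightarrow> (nat \<Rightarrow> rpoly) \<Rightarrow> (nat \<Rightarrow> rpoly) \<Rightarrow> nat" where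
  "dmin m N p q g = Max ((\<Union>i\<in>{1..N}. {dhalf (p i), dhalf (q i)}) \<union> dhalf ` g ` {1..m})"

definition Uset :: "nat \<Rightarrow> (nat \<Rightarrow> nat set) \<Rightarrow> nat \<Rightarrow> nat set" where
  "Uset N I i = {j. i < j \<and> j \<le> N \<and> I i \<inter> I j \<noteq> {}}"

definition Asupp :: "nat \<Rightarrow> nat \<Rightarrow> (nat \<Rightarrow> rpoly) \<Rightarrow> (nat \<Rightarrow> rpoly) \<Rightarrow> (nat \<Rightarrow> rpoly) \<Rightarrow> monomial set" where
  "Asupp m N p q g = (\<Union>i\<in>{1..N}. Poly_Mapping.keys (p i) \<union> Poly_Mapping.keys (q i)) \<union> (\<Union>j\<in>{1..m}. Poly_Mapping.keys (g j))"

definition rdot :: "nat \<Rightarrow> (nat \<Rightarrow> nat) \<Rightarrow> monomial \<Rightarrow> nat" where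
  "rdot n r a = (\<Sum>l\<in>{1..n}. r l * Poly_Mapping.lookup a l)"

definition Rset :: "nat \<Rightarrow> monomial set \<Rightarrow> (nat \<Rightarrow> nat) set" where
  "Rset n A = {r. (\<forall>l\<in>{1..n}. r l \<in> {0,1}) \<and> (\<forall>l. l \<notin> {1..n} \<longrightarrow> r l = 0)
                 \<and> (\<forall>a\<in>A. even (rdot n r a))}"

definition Abar :: "nat \<Rightarrow> monomial set \<Rightarrow> monomial set" where
  "Abar n A = {a. \<forall>r\<in>Rset n A. even (rdot n r a)}"

definition feas_c :: "nat \<Rightarrow> nat \<Rightarrow> (nat \<Rightarrow> rpoly) \<Rightarrow> (nat \<Rightarrow> rpoly) \<Rightarrow>
    (nat \<Rightarrow> nat set) \<Rightarrow> (nat \<Rightarrow> nat set) \<Rightarrow> nat \<Rightarrow> (nat \<Rightarrow> monomial \<Rightarrow> real) \<Rightarrow> bool" where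
  "feas_c N m q g I J k y \<longleftrightarrow>
     (\<forall>i\<in>{1..N}.
        (\<forall>a. a \<notin> mons (I i) (2*k) \<longrightarrow> y i a = 0) \<and>
        psd_on (mons (I i) k) (mom (y i)) \<and>
        (\<forall>j\<in>J i. psd_on (mons (I i) (k - dhalf (g j))) (locm (g j) (y i))) \<and>
        Ly (y i) (q i) = 1) \<and>
     (\<forall>i\<in>{1..N-1}. \<forall>j\<in>Uset N I i.
        \<forall>a\<in>mons (I i \<inter> I j) (2*k - max (pdeg (q i)) (pdeg (q j))).
          Ly (y i) (xmon a * q i) = Ly (y j) (xmon a * q j))"

definition feas_cs :: "nat \<Rightarrow> nat \<Rightarrow> nat \<Rightarrow> (nat \<Rightarrow> rpoly) \<Rightarrow> (nat \<Rightarrow> rpoly) \<Rightarrow> (nat \<Rightarrow> rpoly) \<Rightarrow>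
    (nat \<Rightarrow> nat set) \<Rightarrow> (nat \<Rightarrow> nat set) \<Rightarrow> nat \<Rightarrow> (nat \<Rightarrow> monomial \<Rightarrow> real) \<Rightarrow> bool" where
  "feas_cs n N m p q g I J k y \<longleftrightarrow>
     (let Ab = Abar n (Asupp m N p q g) in
     (\<forall>i\<in>{1..N}.
        (\<forall>a. a \<notin> mons (I i) (2*k) \<longrightarrow> y i a = 0) \<and>
        psd_on (mons (I i) k) (hadB Ab (mom (y i))) \<and>
        (\<forall>j\<in>J i. psd_on (mons (I i) (k - dhalf (g j))) (hadB Ab (locm (g j) (y i)))) \<and>
        Ly (y i) (q i) = 1) \<and>
     (\<forall>i\<in>{1..N-1}. \<forall>j\<in>Uset N I i.
        \<forall>a\<in>mons (I i \<inter> I j) (2*k - max (pdeg (q i)) (pdeg (q j))) \<inter> Ab.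
          Ly (y i) (xmon a * q i) = Ly (y j) (xmon a * q j)))"

definition rho_c :: "nat \<Rightarrow> nat \<Rightarrow> (nat \<Rightarrow> rpoly) \<Rightarrow> (nat \<Rightarrow> rpoly) \<Rightarrow> (nat \<Rightarrow> rpoly) \<Rightarrow>
    (nat \<Rightarrow> nat set) \<Rightarrow> (nat \<Rightarrow> nat set) \<Rightarrow> nat \<Rightarrow> ereal" where
  "rho_c N m p q g I J k =
     Inf {ereal (\<Sum>i\<in>{1..N}. Ly (y i) (p i)) | y. feas_c N m q g I J k y}"

definition rho_cs :: "nat \<Rightarrow> nat \<Rightarrow> nat \<Rightarrow> (nat \<Rightarrow> rpoly) \<Rightarrow> (nat \<Rightarrow> rpoly) \<Rightarrow> (nat \<Rightarrow> rpoly) \<Rightarrow>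
    (nat \<Rightarrow> nat set) \<Rightarrow> (nat \<Rightarrow> nat set) \<Rightarrow> nat \<Rightarrow> ereal" where
  "rho_cs n N m p q g I J k =
     Inf {ereal (\<Sum>i\<in>{1..N}. Ly (y i) (p i)) | y. feas_cs n N m p q g I J k y}"

text \<open>points of R^S, represented as functions vanishing outside S\<close>
definition pts :: "nat set \<Rightarrow> (nat \<Rightarrow> real) set" where
  "pts S = {x. \<forall>l. l \<notin> S \<longrightarrow> x l = 0}"

end

theory Submission
  imports Defs
begin

text \<open>Zeroing a sequence outside \<open>Abar\<close> turns \<open>M_k(y)\<close> into its Hadamard product with the sign
  symmetry matrix, and this product only keeps diagonal blocks; so the two relaxations attain the
  same values. Point evaluations divided by \<open>q_i(x)\<close> show that the values are at most \<open>\<rho>\<close>.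

  For the lower bound no measures are needed. Given \<open>c < \<rho>\<close>, extend \<open>p_i / q_i\<close> to a large cube, add
  an exact penalty for the constraints, and eliminate the cliques one by one along the running
  intersection property: minimising the last summand over its private variables gives a continuous
  function of the shared ones, which Stone-Weierstrass replaces by a polynomial. This yields
  polynomials \<open>H_i\<close> in the variables \<open>I_i\<close> with \<open>p_i + q_i (H_i - c/N) > 0\<close> on \<open>K_i\<close> whose contributions
  \<open>L_i(q_i H_i)\<close> cancel by the linking equalities. Putinar's theorem makes each
  \<open>L_i(p_i + q_i (H_i - c/N))\<close> nonnegative for large \<open>k\<close>, and summation gives \<open>c\<close>.

  Putinar's theorem itself follows by subtracting \<open>c (1 - g_j/T_j)^(2K) g_j\<close> from the polynomial
  to make it positive on a cube. There its Bernstein coefficients are eventually positive, and the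
  linear forms \<open>R + x_l\<close>, \<open>R - x_l\<close> lie in the preordering of the ball.\<close>

section \<open>Polynomials as linear combinations of monomials\<close>

lemma Ly_superset:
  assumes "finite S" "Poly_Mapping.keys f \<subseteq> S"
  shows "Ly y f = (\<Sum>a\<in>S. Poly_Mapping.lookup f a * y a)"
  unfolding Ly_def
  by (rule sum.mono_neutral_left) (use assms in \<open>auto simp: in_keys_iff\<close>)

lemma Ly_zero [simp]: "Ly y 0 = 0"
  by (simp add: Ly_def)

lemma Ly_add: "Ly y (f + g) = Ly y f + Ly y g"
proof -
  let ?S = "Poly_Mapping.keys f \<union> Poly_Mapping.keys g"
  have S: "finite ?S" by simp
  show ?thesis
    by (subst (1 2 3) Ly_superset[OF S])
       (auto simp: lookup_add sum.distrib algebra_simps dest: Poly_Mapping.keys_add[THEN subsetD])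
qed

lemma Ly_single [simp]: "Ly y (Poly_Mapping.single a c) = c * y a"
  by (simp add: Ly_def)

lemma Ly_uminus: "Ly y (- f) = - Ly y f"
  by (simp add: Ly_def sum_negf)

lemma Ly_diff: "Ly y (f - g) = Ly y f - Ly y g"
  using Ly_add[of y f "- g"] by (simp add: Ly_uminus)

lemma Ly_sum: "Ly y (\<Sum>i\<in>A. f i) = (\<Sum>i\<in>A. Ly y (f i))"
  by (induction A rule: infinite_finite_induct) (auto simp: Ly_add)

lemma rpoly_expansion:
  "(\<Sum>a\<in>Poly_Mapping.keys f. Poly_Mapping.single a (Poly_Mapping.lookup f a)) = (f :: rpoly)"
  by (rule poly_mapping_eqI)
     (auto simp: lookup_sum lookup_single when_def in_keys_iff)

lemma Ly_mult:
  "Ly y (f * g) = (\<Sum>a\<in>Poly_Mapping.keys f. \<Sum>b\<in>Poly_Mapping.keys g.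
      Poly_Mapping.lookup f a * Poly_Mapping.lookup g b * y (a + b))"
proof -
  have "f * g = (\<Sum>a\<in>Poly_Mapping.keys f. Poly_Mapping.single a (Poly_Mapping.lookup f a)) *
                (\<Sum>b\<in>Poly_Mapping.keys g. Poly_Mapping.single b (Poly_Mapping.lookup g b))"
    by (simp only: rpoly_expansion)
  then show ?thesis
    by (simp add: sum_product mult_single Ly_sum)
qed

lemma Ly_mult_superset:
  assumes "finite A" "Poly_Mapping.keys f \<subseteq> A" "finite B" "Poly_Mapping.keys g \<subseteq> B"
  shows "Ly y (f * g) = (\<Sum>a\<in>A. \<Sum>b\<in>B.
      Poly_Mapping.lookup f a * Poly_Mapping.lookup g b * y (a + b))"
proof -
  have 1: "(\<Sum>b\<in>Poly_Mapping.keys g. Poly_Mapping.lookup f a * Poly_Mapping.lookup g b * y (a + b))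
    = (\<Sum>b\<in>B. Poly_Mapping.lookup f a * Poly_Mapping.lookup g b * y (a + b))" for a
    by (rule sum.mono_neutral_left) (use assms in \<open>auto simp: in_keys_iff\<close>)
  show ?thesis
    unfolding Ly_mult 1
    by (rule sum.mono_neutral_left) (use assms in \<open>auto simp: in_keys_iff\<close>)
qed

lemma Ly_cong:
  assumes "\<And>a. a \<in> Poly_Mapping.keys f \<Longrightarrow> y a = z a"
  shows "Ly y f = Ly z f"
  unfolding Ly_def by (rule sum.cong) (auto simp: assms)

section \<open>Evaluation at a point as a linear functional\<close>

definition meval :: "(nat \<Rightarrow> real) \<Rightarrow> monomial \<Rightarrow> real" where
  "meval x a = (\<Prod>l\<in>Poly_Mapping.keys a. x l ^ Poly_Mapping.lookup a l)"

lemma meval_superset: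
  assumes "finite S" "Poly_Mapping.keys a \<subseteq> S"
  shows "meval x a = (\<Prod>l\<in>S. x l ^ Poly_Mapping.lookup a l)"
  unfolding meval_def
  by (rule prod.mono_neutral_left) (use assms in \<open>auto simp: in_keys_iff\<close>)

lemma meval_0 [simp]: "meval x 0 = 1"
  by (simp add: meval_def)

lemma meval_add: "meval x (a + b) = meval x a * meval x b"
proof -
  let ?S = "Poly_Mapping.keys a \<union> Poly_Mapping.keys b"
  have S: "finite ?S" by simp
  show ?thesis
    by (subst (1 2 3) meval_superset[OF S])
       (auto simp: lookup_add prod.distrib power_add dest: Poly_Mapping.keys_add[THEN subsetD])
qed

lemma meval_single [simp]: "meval x (Poly_Mapping.single l e) = x l ^ e"
  by (simp add: meval_def)

text \<open>Evaluation is the functional whose moments are those of the Dirac measure at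
  \<open>x\<close>. Its additive laws are therefore those of \<open>Ly\<close>, and multiplicativity
  comes from \<open>meval_add\<close>.\<close>

lemma peval_eq_Ly: "peval f x = Ly (meval x) f"
  by (simp add: peval_def Ly_def meval_def)

lemma peval_single [simp]: "peval (Poly_Mapping.single a c) x = c * meval x a"
  by (simp add: peval_eq_Ly)

lemma peval_zero [simp]: "peval 0 x = 0"
  by (simp add: peval_eq_Ly)

lemma peval_one [simp]: "peval 1 x = 1"
  using peval_single[of 0 1 x] by (simp del: peval_single)

lemma peval_add [simp]: "peval (f + g) x = peval f x + peval g x"
  by (simp add: peval_eq_Ly Ly_add)

lemma peval_uminus [simp]: "peval (- f) x = - peval f x"
  by (simp add: peval_eq_Ly Ly_uminus)

lemma peval_diff [simp]: "peval (f - g) x = peval f x - peval g x"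
  by (simp add: peval_eq_Ly Ly_diff)

lemma peval_sum [simp]: "peval (\<Sum>i\<in>A. f i) x = (\<Sum>i\<in>A. peval (f i) x)"
  by (simp add: peval_eq_Ly Ly_sum)

lemma peval_mult [simp]: "peval (f * g) x = peval f x * peval g x"
  by (simp add: peval_eq_Ly Ly_mult meval_add) (simp add: Ly_def sum_product algebra_simps)

lemma peval_power [simp]: "peval (f ^ k) x = peval f x ^ k"
  by (induction k) auto

lemma peval_cong:
  assumes "vars_in S f" "\<And>l. l \<in> S \<Longrightarrow> x l = z l"
  shows "peval f x = peval f z"
  unfolding peval_def
  by (intro sum.cong prod.cong arg_cong2[where f="(*)"] refl)
     (use assms in \<open>auto simp: vars_in_def subset_iff\<close>)

lemma continuous_on_peval [continuous_intros]: "continuous_on S (peval f)"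
proof -
  have "continuous_on S (\<lambda>x. \<Sum>a\<in>Poly_Mapping.keys f.
      Poly_Mapping.lookup f a * (\<Prod>l\<in>Poly_Mapping.keys a. x l ^ Poly_Mapping.lookup a l))"
    by (intro continuous_intros continuous_on_subset[OF continuous_on_product_coordinates]) auto
  then show ?thesis
    by (simp add: peval_def[abs_def])
qed

lemma vars_in_mono: "vars_in S f \<Longrightarrow> S \<subseteq> T \<Longrightarrow> vars_in T f"
  unfolding vars_in_def by blast

lemma vars_in_zero [simp]: "vars_in S 0"
  by (simp add: vars_in_def)

lemma vars_in_single: "Poly_Mapping.keys a \<subseteq> S \<Longrightarrow> vars_in S (Poly_Mapping.single a c)"
  by (simp add: vars_in_def)

lemma vars_in_const [simp]: "vars_in S (Poly_Mapping.single 0 c)"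
  by (simp add: vars_in_single)

lemma vars_in_one [simp]: "vars_in S 1"
  using vars_in_const[of S 1] by simp

lemma vars_in_add: "vars_in S f \<Longrightarrow> vars_in S g \<Longrightarrow> vars_in S (f + g)"
  unfolding vars_in_def using Poly_Mapping.keys_add[of f g] by blast

lemma vars_in_uminus: "vars_in S f \<Longrightarrow> vars_in S (- f)"
  unfolding vars_in_def by simp

lemma vars_in_diff: "vars_in S f \<Longrightarrow> vars_in S g \<Longrightarrow> vars_in S (f - g)"
  using vars_in_add[of S f "- g"] vars_in_uminus[of S g] by simp

lemma vars_in_mult:
  assumes "vars_in S f" "vars_in S g"
  shows "vars_in S (f * g)"
  unfolding vars_in_def
proof
  fix c assume "c \<in> Poly_Mapping.keys (f * g)"
  then obtain a b where "c = a + b" "a \<in> Poly_Mapping.keys f" "b \<in> Poly_Mapping.keys g"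
    using keys_mult[of f g] by blast
  then show "Poly_Mapping.keys c \<subseteq> S"
    using assms Poly_Mapping.keys_add[of a b] unfolding vars_in_def by blast
qed

lemma vars_in_power: "vars_in S f \<Longrightarrow> vars_in S (f ^ k)"
  by (induction k) (auto intro: vars_in_mult)

lemma vars_in_sum: "(\<And>i. i \<in> A \<Longrightarrow> vars_in S (f i)) \<Longrightarrow> vars_in S (\<Sum>i\<in>A. f i)"
  by (induction A rule: infinite_finite_induct) (auto intro: vars_in_add)

lemma vars_in_prod: "(\<And>i. i \<in> A \<Longrightarrow> vars_in S (f i)) \<Longrightarrow> vars_in S (\<Prod>i\<in>A. f i)"
  by (induction A rule: infinite_finite_induct) (auto intro: vars_in_mult)

lemmas vars_in_intros = vars_in_add vars_in_uminus vars_in_diff vars_in_mult vars_in_power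
  vars_in_sum vars_in_prod

section \<open>Degrees and the index sets of truncated sequences\<close>

lemma mdeg_superset:
  assumes "finite S" "Poly_Mapping.keys a \<subseteq> S"
  shows "mdeg a = (\<Sum>l\<in>S. Poly_Mapping.lookup a l)"
  unfolding mdeg_def
  by (rule sum.mono_neutral_left) (use assms in \<open>auto simp: in_keys_iff\<close>)

lemma mdeg_add: "mdeg (a + b) = mdeg a + mdeg b"
proof -
  let ?S = "Poly_Mapping.keys a \<union> Poly_Mapping.keys b"
  have S: "finite ?S" by simp
  show ?thesis
    by (subst (1 2 3) mdeg_superset[OF S])
       (auto simp: lookup_add sum.distrib dest: Poly_Mapping.keys_add[THEN subsetD])
qed

lemma mdeg_le_pdeg: "a \<in> Poly_Mapping.keys f \<Longrightarrow> mdeg a \<le> pdeg f"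
  by (simp add: pdeg_def)

lemma pdeg_le_dhalf: "pdeg f \<le> 2 * dhalf f"
  by (simp add: dhalf_def)

lemma finite_mons:
  assumes "finite S"
  shows "finite (mons S d)"
proof (rule finite_imageD)
  let ?F = "{f. \<forall>l. (l \<in> S \<longrightarrow> f l \<in> {..d}) \<and> (l \<notin> S \<longrightarrow> f l = (0::nat))}"
  have "Poly_Mapping.lookup ` mons S d \<subseteq> ?F"
  proof clarify
    fix a l assume a: "a \<in> mons S d"
    have "Poly_Mapping.lookup a l \<le> mdeg a"
      unfolding mdeg_def
      by (cases "l \<in> Poly_Mapping.keys a") (auto simp: member_le_sum in_keys_iff)
    then show "(l \<in> S \<longrightarrow> Poly_Mapping.lookup a l \<in> {..d}) \<and> (l \<notin> S \<longrightarrow> Poly_Mapping.lookup a l = 0)"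
      using a by (auto simp: mons_def in_keys_iff)
  qed
  moreover have "finite ?F"
    by (rule finite_set_of_finite_funs) (use assms in auto)
  ultimately show "finite (Poly_Mapping.lookup ` mons S d)"
    by (rule finite_subset)
  show "inj_on Poly_Mapping.lookup (mons S d)"
    by (rule inj_onI) (simp add: poly_mapping.lookup_inject)
qed

lemma mons_add:
  assumes "a \<in> mons S d" "b \<in> mons S e"
  shows "a + b \<in> mons S (d + e)"
  using assms Poly_Mapping.keys_add[of a b] by (auto simp: mons_def mdeg_add)

lemma mons_mono: "S \<subseteq> T \<Longrightarrow> d \<le> e \<Longrightarrow> mons S d \<subseteq> mons T e"
  by (auto simp: mons_def)

lemma keys_in_mons: "vars_in S f \<Longrightarrow> pdeg f \<le> d \<Longrightarrow> Poly_Mapping.keys f \<subseteq> mons S d"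
  by (auto simp: mons_def vars_in_def dest: mdeg_le_pdeg)

section \<open>Moment and localizing matrices as quadratic forms\<close>

lemma locm_eq_Ly: "locm f y a b = Ly (\<lambda>c. y (c + a + b)) f"
  by (simp add: locm_def Ly_def)

text \<open>The right-hand side is the quadratic form of the moment matrix at the coefficient vector
  of \<open>h\<close>; this turns semidefiniteness into nonnegativity on squares.\<close>

lemma Ly_square_mom:
  assumes "finite A" "Poly_Mapping.keys h \<subseteq> A"
  shows "Ly y (h * h) = (\<Sum>a\<in>A. \<Sum>b\<in>A.
      Poly_Mapping.lookup h a * mom y a b * Poly_Mapping.lookup h b)"
  by (simp add: Ly_mult_superset[OF assms assms] mom_def algebra_simps)

text \<open>Absorbing \<open>f\<close> into the sequence, so that its entry at \<open>c\<close>
  becomes the value of the functional at \<open>f\<close> shifted by \<open>c\<close>, turns the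
  localizing matrix into an ordinary moment matrix.\<close>

lemma Ly_square_locm:
  assumes "finite A" "Poly_Mapping.keys h \<subseteq> A"
  shows "Ly y (h * h * f) = (\<Sum>a\<in>A. \<Sum>b\<in>A.
      Poly_Mapping.lookup h a * locm f y a b * Poly_Mapping.lookup h b)"
proof -
  have "Ly y (f * (h * h)) = Ly (\<lambda>c. Ly (\<lambda>d. y (d + c)) f) (h * h)"
    by (subst Ly_mult)
       (simp add: Ly_def sum_distrib_left algebra_simps sum.swap[of _ "Poly_Mapping.keys f"])
  also have "\<dots> = (\<Sum>a\<in>A. \<Sum>b\<in>A.
      Poly_Mapping.lookup h a * locm f y a b * Poly_Mapping.lookup h b)"
    by (simp add: Ly_mult_superset[OF assms assms] locm_eq_Ly algebra_simps)
  finally show ?thesis by (simp add: mult.commute)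
qed

section \<open>Separating a sparse sum into positive summands\<close>

definition cube :: "real \<Rightarrow> (nat \<Rightarrow> real) set" where
  "cube R = {x. \<forall>l. \<bar>x l\<bar> \<le> R}"

text \<open>Tychonoff: all coordinates are bounded, not just those of the ambient variables, so the
  cube is compact in the product topology on sequences and no passage to finitely many coordinates
  is required.\<close>

lemma compact_cube: "compact (cube R)"
proof -
  have "cube R = PiE UNIV (\<lambda>_. {-R..R})"
    by (auto simp: cube_def PiE_def Pi_def abs_le_iff minus_le_iff)
  moreover have "compactin (product_topology (\<lambda>_::nat. euclidean :: real topology) UNIV) (PiE UNIV (\<lambda>_. {-R..R}))"
    unfolding compactin_PiE by simp
  ultimately show ?thesis
    by (simp add: euclidean_product_topology)
qed

lemma compact_pos_lower_bound:
  fixes G :: "'a::topological_space \<Rightarrow> real"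
  assumes "compact S" "continuous_on S G" "\<And>x. x \<in> S \<Longrightarrow> 0 < G x"
  shows "\<exists>\<delta>>0. \<forall>x\<in>S. \<delta> \<le> G x"
proof (cases "S = {}")
  case True
  then show ?thesis by (auto intro: exI[of _ 1])
next
  case False
  then obtain x where "x \<in> S" "\<forall>y\<in>S. G x \<le> G y"
    using continuous_attains_inf[OF assms(1) _ assms(2)] by blast
  then show ?thesis using assms(3) by blast
qed

text \<open>Where \<open>G\<close> is positive any nonnegative multiple of \<open>P\<close> is
  harmless. The remaining set is compact and avoids the zeros of \<open>P\<close>, so
  \<open>P\<close> has a positive lower bound \<delta> there; with \<open>-B\<close> a lower bound
  of \<open>G\<close>, a factor exceeding \<open>B / \<delta>\<close> suffices.\<close>

lemma compact_exact_penalty: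
  fixes G P :: "'a::t2_space \<Rightarrow> real"
  assumes S: "compact S" and G: "continuous_on S G" and P: "continuous_on S P"
    and P0: "\<And>x. x \<in> S \<Longrightarrow> 0 \<le> P x" and GP: "\<And>x. x \<in> S \<Longrightarrow> P x = 0 \<Longrightarrow> 0 < G x"
  shows "\<exists>c\<ge>0. \<forall>x\<in>S. 0 < G x + c * P x"
proof -
  define A where "A = {x \<in> S. G x \<le> 0}"
  have A: "compact A"
    unfolding A_def by (rule closedin_compact[OF S])
      (use continuous_closedin_preimage[OF G, of "{..0}"] in \<open>simp add: vimage_def Int_def\<close>)
  have AS: "A \<subseteq> S" by (auto simp: A_def)
  have "\<exists>\<delta>>0. \<forall>x\<in>A. \<delta> \<le> P x"
  proof (rule compact_pos_lower_bound[OF A continuous_on_subset[OF P AS]])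
    fix x assume "x \<in> A"
    then show "0 < P x" using P0[of x] GP[of x] by (auto simp: A_def order.order_iff_strict)
  qed
  then obtain \<delta> where \<delta>: "\<delta> > 0" "\<And>x. x \<in> A \<Longrightarrow> \<delta> \<le> P x" by blast
  have "bounded (G ` S)"
    by (rule compact_imp_bounded[OF compact_continuous_image[OF G S]])
  then obtain B where B: "B > 0" "\<And>x. x \<in> S \<Longrightarrow> \<bar>G x\<bar> \<le> B"
    by (auto simp: bounded_pos)
  define c where "c = (B + 1) / \<delta>"
  have c0: "c \<ge> 0" using B \<delta> by (simp add: c_def)
  have "0 < G x + c * P x" if x: "x \<in> S" for x
  proof (cases "x \<in> A")
    case True
    have "B + 1 = c * \<delta>" using \<delta>(1) by (simp add: c_def)
    also have "\<dots> \<le> c * P x" by (rule mult_left_mono[OF \<delta>(2)[OF True] c0])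
    finally show ?thesis using B(2)[OF x] by linarith
  next
    case False
    then show ?thesis
      using x mult_nonneg_nonneg[OF c0 P0[OF x]] by (simp add: A_def)
  qed
  with c0 show ?thesis by blast
qed

section \<open>Elimination of variables by partial minimisation\<close>

definition depends_on :: "nat set \<Rightarrow> ((nat \<Rightarrow> real) \<Rightarrow> real) \<Rightarrow> bool" where
  "depends_on S F \<longleftrightarrow> (\<forall>x y. (\<forall>l\<in>S. x l = y l) \<longrightarrow> F x = F y)"

lemma depends_onD: "depends_on S F \<Longrightarrow> (\<And>l. l \<in> S \<Longrightarrow> x l = y l) \<Longrightarrow> F x = F y"
  unfolding depends_on_def by blast

lemma depends_on_peval: "vars_in S f \<Longrightarrow> depends_on S (peval f)"
  unfolding depends_on_def by (auto intro: peval_cong)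

definition merge_pts :: "nat set \<Rightarrow> (nat \<Rightarrow> real) \<Rightarrow> (nat \<Rightarrow> real) \<Rightarrow> nat \<Rightarrow> real" where
  "merge_pts S x z = (\<lambda>l. if l \<in> S then x l else z l)"

lemma merge_pts_cube: "x \<in> cube R \<Longrightarrow> z \<in> cube R \<Longrightarrow> merge_pts S x z \<in> cube R"
  by (auto simp: cube_def merge_pts_def)

text \<open>The metric is a weighted sum of truncated coordinate distances, and merging either keeps
  such a distance or makes it 0.\<close>

lemma dist_merge_pts_le: "dist (merge_pts S x z) (merge_pts S x' z) \<le> dist x x'"
  unfolding dist_fun_def
proof (rule suminf_le)
  have sm: "summable (\<lambda>n. (1/2)^n * min (dist (a (from_nat n)) (b (from_nat n))) 1)" for a b :: "nat \<Rightarrow> real"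
    by (rule summable_comparison_test'[where g="\<lambda>n. (1/2)^n" and N=0]) auto
  show "summable (\<lambda>n. (1/2)^n * min (dist (merge_pts S x z (from_nat n)) (merge_pts S x' z (from_nat n))) 1)"
    by (rule sm)
  show "summable (\<lambda>n. (1/2)^n * min (dist (x (from_nat n)) (x' (from_nat n))) 1)"
    by (rule sm)
qed (auto simp: merge_pts_def intro!: mult_left_mono)

text \<open>The minimisation is over the coordinates outside \<open>S\<close>. Letting
  \<open>z\<close> run through the whole cube keeps the domain of minimisation compact and
  independent of \<open>x\<close>.\<close>

definition min_over :: "real \<Rightarrow> nat set \<Rightarrow> ((nat \<Rightarrow> real) \<Rightarrow> real) \<Rightarrow> (nat \<Rightarrow> real) \<Rightarrow> real" where
  "min_over R S F x = (INF z\<in>cube R. F (merge_pts S x z))"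

lemma continuous_on_merge_pts: "continuous_on A (merge_pts S x)"
proof (rule continuous_on_coordinatewise_then_product)
  fix l show "continuous_on A (\<lambda>z. merge_pts S x z l)"
    by (cases "l \<in> S")
      (auto simp: merge_pts_def intro: continuous_on_subset[OF continuous_on_product_coordinates])
qed

lemma min_over_attained:
  assumes R: "0 \<le> R" and F: "continuous_on (cube R) F" and x: "x \<in> cube R"
  shows "\<exists>z\<in>cube R. min_over R S F x = F (merge_pts S x z) \<and>
           (\<forall>w\<in>cube R. F (merge_pts S x z) \<le> F (merge_pts S x w))"
proof -
  have "continuous_on (cube R) (\<lambda>z. F (merge_pts S x z))"
    by (rule continuous_on_compose2[OF F continuous_on_merge_pts]) (use merge_pts_cube x in auto)
  moreover have "cube R \<noteq> {}"
    using R by (auto simp: cube_def intro: exI[of _ "\<lambda>_. 0"])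
  ultimately obtain z where z: "z \<in> cube R" "\<forall>w\<in>cube R. F (merge_pts S x z) \<le> F (merge_pts S x w)"
    using continuous_attains_inf[OF compact_cube] by blast
  moreover have "min_over R S F x = F (merge_pts S x z)"
    unfolding min_over_def
    by (rule cInf_eq_minimum) (use z in auto)
  ultimately show ?thesis by blast
qed

text \<open>By uniform continuity of \<open>F\<close>, a minimiser for one point is a competitor at
  any nearby point with value changed by less than \<open>e\<close>. Exchanging the two points gives
  the other inequality.\<close>

lemma continuous_on_min_over:
  assumes R: "0 \<le> R" and F: "continuous_on (cube R) F"
  shows "continuous_on (cube R) (min_over R S F)"
proof -
  have "uniformly_continuous_on (cube R) F"
    by (rule compact_uniformly_continuous[OF F compact_cube])
  have "\<exists>d>0. \<forall>x'\<in>cube R. dist x' x < d \<longrightarrow> dist (min_over R S F x') (min_over R S F x) < e"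
    if x: "x \<in> cube R" and e: "e > 0" for x e
  proof -
    obtain d where d: "d > 0" "\<And>u v. u \<in> cube R \<Longrightarrow> v \<in> cube R \<Longrightarrow> dist u v < d \<Longrightarrow> dist (F u) (F v) < e"
      using \<open>uniformly_continuous_on (cube R) F\<close> e unfolding uniformly_continuous_on_def by metis
    have less: "min_over R S F u < min_over R S F v + e"
      if u: "u \<in> cube R" and v: "v \<in> cube R" and uv: "dist u v < d" for u v
    proof -
      obtain z where z: "z \<in> cube R" "min_over R S F v = F (merge_pts S v z)"
        using min_over_attained[OF R F v, of S] by blast
      obtain w where w: "min_over R S F u = F (merge_pts S u w)" "\<forall>w'\<in>cube R. F (merge_pts S u w) \<le> F (merge_pts S u w')"
        using min_over_attained[OF R F u, of S] by blast
      have "dist (merge_pts S u z) (merge_pts S v z) < d"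
        using dist_merge_pts_le[of S u z v] uv by linarith
      then have "dist (F (merge_pts S u z)) (F (merge_pts S v z)) < e"
        by (intro d(2) merge_pts_cube u v z(1))
      moreover have "F (merge_pts S u w) \<le> F (merge_pts S u z)" using w(2) z(1) by blast
      ultimately show ?thesis unfolding z(2) w(1) dist_real_def by linarith
    qed
    have "dist (min_over R S F x') (min_over R S F x) < e" if "x' \<in> cube R" "dist x' x < d" for x'
      using less[OF that(1) x that(2)] less[OF x that(1)] that(2) by (simp add: dist_commute dist_real_def)
    with d(1) show ?thesis by blast
  qed
  then show ?thesis unfolding continuous_on_iff by blast
qed

lemma depends_on_min_over: "depends_on S (min_over R S F)"
proof -
  have "merge_pts S x = merge_pts S y" if "\<forall>l\<in>S. x l = y l" for x y
    using that by (auto simp: merge_pts_def fun_eq_iff)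
  then show ?thesis
    unfolding depends_on_def min_over_def by metis
qed

section \<open>Polynomial approximation in the shared variables\<close>

definition restrict_poly :: "nat set \<Rightarrow> rpoly \<Rightarrow> rpoly" where
  "restrict_poly S f = (\<Sum>a\<in>{a\<in>Poly_Mapping.keys f. Poly_Mapping.keys a \<subseteq> S}.
      Poly_Mapping.single a (Poly_Mapping.lookup f a))"

lemma vars_in_restrict_poly: "vars_in S (restrict_poly S f)"
  unfolding restrict_poly_def by (intro vars_in_sum vars_in_single) auto

text \<open>A monomial with a variable outside \<open>S\<close> vanishes once that variable is set
  to 0, and the other monomials do not notice the substitution.\<close>

lemma peval_restrict_poly: "peval (restrict_poly S f) x = peval f (merge_pts S x (\<lambda>_. 0))"
proof -
  let ?x = "merge_pts S x (\<lambda>_. 0)"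
  have 1: "meval ?x a = (if Poly_Mapping.keys a \<subseteq> S then meval x a else 0)" for a
  proof (cases "Poly_Mapping.keys a \<subseteq> S")
    case True
    then show ?thesis by (auto simp: meval_def merge_pts_def intro!: prod.cong)
  next
    case False
    then obtain l where "l \<in> Poly_Mapping.keys a" "l \<notin> S" by blast
    then have "meval ?x a = 0"
      unfolding meval_def
      by (intro prod_zero bexI[of _ l]) (auto simp: merge_pts_def in_keys_iff)
    with False show ?thesis by simp
  qed
  have "peval f ?x = (\<Sum>a\<in>Poly_Mapping.keys f. if Poly_Mapping.keys a \<subseteq> S then Poly_Mapping.lookup f a * meval x a else 0)"
    unfolding peval_eq_Ly Ly_def 1 by (rule sum.cong) auto
  also have "\<dots> = peval (restrict_poly S f) x"
    by (simp add: restrict_poly_def sum.If_cases Int_def)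
  finally show ?thesis by simp
qed

text \<open>Stone-Weierstrass gives an approximant in arbitrary variables. Setting those outside
  \<open>S\<close> to 0 keeps the error: the modified point stays in the cube and \<phi> has the
  same value there.\<close>

lemma polynomial_approximation:
  assumes R: "0 \<le> R" and cont: "continuous_on (cube R) \<phi>" and dep: "depends_on S \<phi>" and e: "0 < e"
  shows "\<exists>h. vars_in S h \<and> (\<forall>x\<in>cube R. \<bar>\<phi> x - peval h x\<bar> < e)"
proof -
  interpret function_ring_on "range peval" "cube R"
  proof
    show "compact (cube R)" by (rule compact_cube)
    show "continuous_on (cube R) f" if "f \<in> range peval" for f
      using that continuous_on_peval by auto
    show "(\<lambda>x. f x + g x) \<in> range peval" if fg: "f \<in> range peval" "g \<in> range peval" for f g
    proof -
      obtain a b where "f = peval a" "g = peval b" using fg by blast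
      then have "(\<lambda>x. f x + g x) = peval (a + b)" by auto
      then show ?thesis by blast
    qed
    show "(\<lambda>x. f x * g x) \<in> range peval" if fg: "f \<in> range peval" "g \<in> range peval" for f g
    proof -
      obtain a b where "f = peval a" "g = peval b" using fg by blast
      then have "(\<lambda>x. f x * g x) = peval (a * b)" by auto
      then show ?thesis by blast
    qed
    show "(\<lambda>_. c) \<in> range peval" for c
    proof -
      have "(\<lambda>_. c) = peval (Poly_Mapping.single 0 c)" by auto
      then show ?thesis by blast
    qed
    show "\<exists>f\<in>range peval. f x \<noteq> f y" if xy: "x \<noteq> y" for x y
    proof -
      obtain l where "x l \<noteq> y l" using xy by blast
      then have "peval (Poly_Mapping.single (Poly_Mapping.single l 1) 1) x
          \<noteq> peval (Poly_Mapping.single (Poly_Mapping.single l 1) 1) y"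
        by simp
      then show ?thesis by blast
    qed
  qed
  obtain f where f: "\<And>x. x \<in> cube R \<Longrightarrow> \<bar>\<phi> x - peval f x\<bar> < e"
    using Stone_Weierstrass_basic[OF cont e] by blast
  have "\<bar>\<phi> x - peval (restrict_poly S f) x\<bar> < e" if x: "x \<in> cube R" for x
  proof -
    have "merge_pts S x (\<lambda>_. 0) \<in> cube R"
      by (rule merge_pts_cube[OF x]) (use R in \<open>simp add: cube_def\<close>)
    moreover have "\<phi> (merge_pts S x (\<lambda>_. 0)) = \<phi> x"
      by (rule depends_onD[OF dep]) (simp add: merge_pts_def)
    ultimately show ?thesis using f peval_restrict_poly by metis
  qed
  with vars_in_restrict_poly show ?thesis by blast
qed

section \<open>Decomposition along the running intersection property\<close>

text \<open>Abstracts what the linking equalities provide, with \<open>L i h\<close> standing for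
  \<open>Ly (y i) (h * q i)\<close>. The bound \<open>D\<close> reflects that a relaxation of finite
  order links moments only up to some degree.\<close>

definition linked :: "nat \<Rightarrow> (nat \<Rightarrow> nat set) \<Rightarrow> nat \<Rightarrow> (nat \<Rightarrow> rpoly \<Rightarrow> real) \<Rightarrow> bool" where
  "linked N I D L \<longleftrightarrow> (\<forall>i\<in>{1..N}. \<forall>a b. L i (a + b) = L i a + L i b) \<and>
     (\<forall>i\<in>{1..N}. \<forall>j\<in>{1..<i}. \<forall>h. vars_in (I i \<inter> I j) h \<longrightarrow> pdeg h \<le> D \<longrightarrow> L i h = L j h)"

lemma linked_mono:
  assumes "linked N I D L" "M \<le> N" "E \<le> D"
  shows "linked M I E L"
  using assms unfolding linked_def by fastforce

text \<open>Induction on the number of cliques. The last clique meets the earlier ones in a set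
  \<open>S\<close> inside one \<open>I k\<close>. A polynomial \<open>h\<close> in the variables
  \<open>S\<close> is taken from the last summand and given to the \<open>k\<close>-th; linked
  functionals agree on \<open>h\<close>, so such transfers cancel in the final sum.\<close>

lemma sparse_decomposition:
  fixes F :: "nat \<Rightarrow> (nat \<Rightarrow> real) \<Rightarrow> real"
  assumes R: "0 \<le> R" and N: "1 \<le> N"
    and cont: "\<And>i. i \<in> {1..N} \<Longrightarrow> continuous_on (cube R) (F i)"
    and dep: "\<And>i. i \<in> {1..N} \<Longrightarrow> depends_on (I i) (F i)"
    and rip: "\<And>i. i \<in> {2..N} \<Longrightarrow> \<exists>k\<in>{1..<i}. I i \<inter> (\<Union>j\<in>{1..<i}. I j) \<subseteq> I k"
    and pos: "\<And>x. x \<in> cube R \<Longrightarrow> 0 < (\<Sum>i\<in>{1..N}. F i x)"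
  shows "\<exists>H D. (\<forall>i\<in>{1..N}. vars_in (I i) (H i)) \<and>
           (\<forall>i\<in>{1..N}. \<forall>x\<in>cube R. 0 < F i x + peval (H i) x) \<and>
           (\<forall>L. linked N I D L \<longrightarrow> (\<Sum>i\<in>{1..N}. L i (H i)) = 0)"
  using N cont dep rip pos
proof (induction N arbitrary: F rule: dec_induct)
  case base
  have "L i 0 = 0" if "linked 1 I 0 L" "i = 1" for L :: "nat \<Rightarrow> rpoly \<Rightarrow> real" and i
  proof -
    have "L i (0 + 0) = L i 0 + L i 0" using that unfolding linked_def by (metis atLeastAtMost_singleton singletonI)
    then show ?thesis by simp
  qed
  then show ?case
    using base by (intro exI[of _ "\<lambda>_. 0"] exI[of _ 0]) auto
next
  case (step N)
  let ?n = "Suc N"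
  define S where "S = I ?n \<inter> (\<Union>j\<in>{1..<?n}. I j)"
  have "\<exists>k\<in>{1..<?n}. S \<subseteq> I k"
    unfolding S_def by (rule step.prems(3)) (use step.hyps in auto)
  then obtain k where k: "k \<in> {1..N}" "S \<subseteq> I k"
    by (metis atLeastLessThanSuc_atLeastAtMost)
  define \<phi> where "\<phi> = min_over R S (F ?n)"
  have Fn: "continuous_on (cube R) (F ?n)" using step.prems(1) by simp
  have phi: "continuous_on (cube R) \<phi>"
    unfolding \<phi>_def by (rule continuous_on_min_over[OF R Fn])
  have pos: "0 < (\<Sum>i\<in>{1..N}. F i x) + \<phi> x" if x: "x \<in> cube R" for x
  proof -
    obtain z where z: "z \<in> cube R" "\<phi> x = F ?n (merge_pts S x z)"
      using min_over_attained[OF R Fn x, of S] unfolding \<phi>_def by blast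
    \<comment> \<open>Only the private variables of the last clique move to the minimiser. Earlier
      summands do not see them, and the last one attains \<open>\<phi> x\<close>.\<close>
    define w where "w = merge_pts (- (I ?n - S)) x z"
    have "F i w = F i x" if i: "i \<in> {1..N}" for i
    proof (rule depends_onD[OF step.prems(2)])
      show "w l = x l" if "l \<in> I i" for l
        using i that by (auto simp: w_def merge_pts_def S_def)
    qed (use i in simp)
    moreover have "F ?n w = \<phi> x"
      unfolding z(2)
      by (rule depends_onD[OF step.prems(2)[of ?n]]) (auto simp: w_def merge_pts_def S_def)
    moreover have "0 < (\<Sum>i\<in>{1..?n}. F i w)"
      by (rule step.prems(4)) (simp add: w_def merge_pts_cube x z)
    ultimately show ?thesis by simp
  qed
  have contN: "continuous_on (cube R) (F i)" if "i \<in> {1..N}" for i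
    using step.prems(1) that by simp
  have "continuous_on (cube R) (\<lambda>x. (\<Sum>i\<in>{1..N}. F i x) + \<phi> x)"
    by (intro continuous_on_add continuous_on_sum contN phi)
  then have "\<exists>\<delta>>0. \<forall>x\<in>cube R. \<delta> \<le> (\<Sum>i\<in>{1..N}. F i x) + \<phi> x"
    by (rule compact_pos_lower_bound[OF compact_cube _ pos])
  then obtain \<delta> where \<delta>: "\<delta> > 0" "\<And>x. x \<in> cube R \<Longrightarrow> \<delta> \<le> (\<Sum>i\<in>{1..N}. F i x) + \<phi> x"
    by blast
  \<comment> \<open>The target \<open>\<phi> - \<delta>/2\<close> with error below
    \<open>\<delta>/2\<close> yields \<open>\<phi> - \<delta> < h < \<phi>\<close>. The upper bound
    makes the last summand minus \<open>h\<close> positive, the lower bound keeps the earlier sum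
    plus \<open>h\<close> positive.\<close>
  have "\<exists>h. vars_in S h \<and> (\<forall>x\<in>cube R. \<bar>(\<phi> x - \<delta>/2) - peval h x\<bar> < \<delta>/2)"
  proof (rule polynomial_approximation[OF R])
    show "continuous_on (cube R) (\<lambda>x. \<phi> x - \<delta>/2)" by (intro continuous_intros phi)
    show "depends_on S (\<lambda>x. \<phi> x - \<delta>/2)"
      using depends_on_min_over[of S R "F ?n"] unfolding depends_on_def \<phi>_def by metis
  qed (use \<delta> in simp)
  then obtain h where h: "vars_in S h" "\<And>x. x \<in> cube R \<Longrightarrow> \<bar>(\<phi> x - \<delta>/2) - peval h x\<bar> < \<delta>/2"
    by blast
  define F' where "F' = F(k := \<lambda>x. F k x + peval h x)"
  have sumF': "(\<Sum>i\<in>{1..N}. F' i x) = (\<Sum>i\<in>{1..N}. F i x) + peval h x" for x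
    using k(1) by (simp add: F'_def sum.remove[of _ k])
  have "\<exists>H D. (\<forall>i\<in>{1..N}. vars_in (I i) (H i)) \<and>
           (\<forall>i\<in>{1..N}. \<forall>x\<in>cube R. 0 < F' i x + peval (H i) x) \<and>
           (\<forall>L. linked N I D L \<longrightarrow> (\<Sum>i\<in>{1..N}. L i (H i)) = 0)"
  proof (rule step.IH)
    show "continuous_on (cube R) (F' i)" if "i \<in> {1..N}" for i
      using contN[OF that] by (auto simp: F'_def intro!: continuous_intros continuous_on_peval)
    show "depends_on (I i) (F' i)" if "i \<in> {1..N}" for i
      using step.prems(2)[of i] that depends_on_peval[OF vars_in_mono[OF h(1) k(2)]]
      by (auto simp: F'_def depends_on_def) (metis+)?
    show "\<exists>k\<in>{1..<i}. I i \<inter> (\<Union>j\<in>{1..<i}. I j) \<subseteq> I k" if "i \<in> {2..N}" for i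
      using step.prems(3)[of i] that by simp
    show "0 < (\<Sum>i\<in>{1..N}. F' i x)" if "x \<in> cube R" for x
      using \<delta>(2)[OF that] h(2)[OF that] unfolding sumF' by linarith
  qed
  then obtain H D where H: "\<And>i. i \<in> {1..N} \<Longrightarrow> vars_in (I i) (H i)"
      "\<And>i x. i \<in> {1..N} \<Longrightarrow> x \<in> cube R \<Longrightarrow> 0 < F' i x + peval (H i) x"
      "\<And>L. linked N I D L \<Longrightarrow> (\<Sum>i\<in>{1..N}. L i (H i)) = 0"
    by blast
  define H' where "H' = (\<lambda>i. if i = ?n then - h else if i = k then H k + h else H i)"
  have kn: "k \<noteq> ?n" using k by auto
  have "vars_in (I i) (H' i)" if "i \<in> {1..?n}" for i
  proof -
    have "vars_in (I ?n) (- h)"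
      by (intro vars_in_uminus vars_in_mono[OF h(1)]) (auto simp: S_def)
    moreover have "vars_in (I k) (H k + h)"
      by (intro vars_in_add vars_in_mono[OF h(1)] H(1) k)
    ultimately show ?thesis using H(1)[of i] that by (auto simp: H'_def)
  qed
  moreover have "0 < F i x + peval (H' i) x" if i: "i \<in> {1..?n}" and x: "x \<in> cube R" for i x
  proof (cases "i = ?n")
    case True
    have "\<phi> x \<le> F ?n x"
    proof -
      obtain z where "z \<in> cube R" "\<phi> x = F ?n (merge_pts S x z)"
          "\<forall>w\<in>cube R. F ?n (merge_pts S x z) \<le> F ?n (merge_pts S x w)"
        using min_over_attained[OF R Fn x, of S] unfolding \<phi>_def by blast
      moreover have "merge_pts S x x = x" by (auto simp: merge_pts_def)
      ultimately show ?thesis using x by metis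
    qed
    moreover have "peval h x < \<phi> x" using h(2)[OF x] by linarith
    ultimately show ?thesis using True by (simp add: H'_def)
  next
    case False
    then show ?thesis using H(2)[of i x] i x by (auto simp: H'_def F'_def)
  qed
  \<comment> \<open>The degree bound must also admit the newly transferred polynomial
    \<open>h\<close>.\<close>
  moreover have "(\<Sum>i\<in>{1..?n}. L i (H' i)) = 0" if L: "linked ?n I (max D (pdeg h)) L" for L
  proof -
    have add: "L i (a + b) = L i a + L i b" if "i \<in> {1..?n}" for i a b
      using L that unfolding linked_def by blast
    have "L ?n (h + (- h)) = L ?n h + L ?n (- h)" "L ?n (0 + 0) = L ?n 0 + L ?n 0"
      by (rule add; simp)+
    then have m: "L ?n (- h) = - L ?n h" by simp
    have "vars_in (I ?n \<inter> I k) h"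
      by (rule vars_in_mono[OF h(1)]) (use k(2) in \<open>auto simp: S_def\<close>)
    then have lk: "L ?n h = L k h"
      using L k(1) unfolding linked_def by simp
    have "(\<Sum>i\<in>{1..N}. L i (H' i)) = (\<Sum>i\<in>{1..N}. L i (H i)) + L k h"
      using k(1) kn add[of k "H k" h] by (simp add: H'_def sum.remove[of _ k])
    moreover have "(\<Sum>i\<in>{1..N}. L i (H i)) = 0"
      by (rule H(3)[OF linked_mono[OF L]]) auto
    ultimately show ?thesis using lk m by (simp add: H'_def)
  qed
  ultimately show ?case by blast
qed

section \<open>Bernstein expansions in the preordering of a ball\<close>

abbreviation (input) const :: "real \<Rightarrow> rpoly" where
  "const \<equiv> Poly_Mapping.single 0"

definition var :: "nat \<Rightarrow> rpoly" where
  "var l = Poly_Mapping.single (Poly_Mapping.single l 1) 1"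

lemma const_mult: "const (c * d) = const c * const d"
  by (simp add: mult_single)

lemma const_sum: "const (\<Sum>i\<in>A. f i) = (\<Sum>i\<in>A. const (f i))"
  by (induction A rule: infinite_finite_induct) (auto simp: single_add)

lemma const_prod: "const (\<Prod>i\<in>A. f i) = (\<Prod>i\<in>A. const (f i))"
  by (induction A rule: infinite_finite_induct) (auto simp: const_mult)

lemma const_power: "const (c ^ k) = const c ^ k"
  by (induction k) (auto simp: const_mult)

lemma var_power: "var l ^ e = Poly_Mapping.single (Poly_Mapping.single l e) 1"
  by (induction e) (auto simp: var_def mult_single single_add[symmetric])

lemma peval_var [simp]: "peval (var l) x = x l"
  by (simp add: var_def)

lemma vars_in_var: "l \<in> S \<Longrightarrow> vars_in S (var l)"
  by (simp add: var_def vars_in_single)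

lemma single_eq_prod_var:
  assumes "finite S" "Poly_Mapping.keys a \<subseteq> S"
  shows "Poly_Mapping.single a c = const c * (\<Prod>l\<in>S. var l ^ Poly_Mapping.lookup a l)"
proof -
  have "(\<Prod>l\<in>S. var l ^ Poly_Mapping.lookup a l) =
      Poly_Mapping.single (\<Sum>l\<in>S. Poly_Mapping.single l (Poly_Mapping.lookup a l)) 1"
    using assms(1) by (induction S rule: finite_induct) (auto simp: var_power mult_single)
  also have "(\<Sum>l\<in>S. Poly_Mapping.single l (Poly_Mapping.lookup a l)) = a"
    by (rule poly_mapping_eqI)
      (use assms in \<open>auto simp: lookup_sum lookup_single when_def in_keys_iff subset_iff\<close>)
  finally show ?thesis by (simp add: mult_single)
qed

section \<open>The preordering of a single polynomial\<close>

text \<open>Sums of squares plus \<open>g\<close> times sums of squares, that is, the quadratic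
  module of \<open>g\<close>. When \<open>g\<close> itself has its variables in \<open>S\<close>, it
  is closed under products and hence a preordering.\<close>

inductive_set poly_preordering :: "nat set \<Rightarrow> rpoly \<Rightarrow> rpoly set" for S g where
  square: "vars_in S h \<Longrightarrow> h * h \<in> poly_preordering S g"
| square_mult: "vars_in S h \<Longrightarrow> h * h * g \<in> poly_preordering S g"
| add: "a \<in> poly_preordering S g \<Longrightarrow> b \<in> poly_preordering S g \<Longrightarrow> a + b \<in> poly_preordering S g"

lemma poly_preordering_const: "0 \<le> c \<Longrightarrow> const c \<in> poly_preordering S g"
  using poly_preordering.square[OF vars_in_const[of S "sqrt c"], of g] by (simp flip: const_mult)

lemma poly_preordering_mult_square:
  assumes "a \<in> poly_preordering S g" "vars_in S h"
  shows "h * h * a \<in> poly_preordering S g"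
  using assms(1)
proof induction
  case (square k)
  then show ?case
    using poly_preordering.square[OF vars_in_mult[OF assms(2) square], of g] by (simp add: ac_simps)
next
  case (square_mult k)
  then show ?case
    using poly_preordering.square_mult[OF vars_in_mult[OF assms(2) square_mult], of g] by (simp add: ac_simps)
qed (simp add: distrib_left poly_preordering.add)

text \<open>A single generator needs no products of generators: \<open>g * g\<close> is a square.\<close>
lemma poly_preordering_mult:
  assumes g: "vars_in S g" and "a \<in> poly_preordering S g" "b \<in> poly_preordering S g"
  shows "a * b \<in> poly_preordering S g"
  using assms(2)
proof induction
  case (square h)
  then show ?case by (rule poly_preordering_mult_square[OF assms(3)])
next
  case (square_mult h)
  have "g * b \<in> poly_preordering S g"
    using assms(3)
  proof induction
    case (square k)
    then show ?case using poly_preordering.square_mult[OF square, of g] by (simp add: ac_simps)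
  next
    case (square_mult k)
    then show ?case
      using poly_preordering.square[OF vars_in_mult[OF g square_mult], of g] by (simp add: ac_simps)
  qed (simp add: distrib_left poly_preordering.add)
  from poly_preordering_mult_square[OF this square_mult] show ?case by (simp add: ac_simps)
qed (simp add: distrib_right poly_preordering.add)

lemma poly_preordering_sum:
  "(\<And>i. i \<in> A \<Longrightarrow> f i \<in> poly_preordering S g) \<Longrightarrow> (\<Sum>i\<in>A. f i) \<in> poly_preordering S g"
  by (induction A rule: infinite_finite_induct)
    (auto intro: poly_preordering.add simp: poly_preordering_const[of 0, simplified])

lemma poly_preordering_prod:
  assumes "vars_in S g"
  shows "(\<And>i. i \<in> A \<Longrightarrow> f i \<in> poly_preordering S g) \<Longrightarrow> (\<Prod>i\<in>A. f i) \<in> poly_preordering S g"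
  by (induction A rule: infinite_finite_induct)
    (auto intro: poly_preordering_mult[OF assms] simp: poly_preordering_const[of 1, simplified])

lemma poly_preordering_power:
  assumes "vars_in S g" "f \<in> poly_preordering S g"
  shows "f ^ k \<in> poly_preordering S g"
  using poly_preordering_prod[of S g "{..<k}" "\<lambda>_. f"] assms by simp

section \<open>Linear forms in the preordering of a ball\<close>

definition ball_poly :: "nat set \<Rightarrow> real \<Rightarrow> rpoly" where
  "ball_poly S M = const M - (\<Sum>l\<in>S. Poly_Mapping.single (Poly_Mapping.single l 2) 1)"

lemma ball_poly_eq: "ball_poly S M = const M - (\<Sum>l\<in>S. var l * var l)"
  using var_power[of _ 2] by (simp add: ball_poly_def power2_eq_square)

lemma vars_in_ball_poly: "vars_in S (ball_poly S M)"
  unfolding ball_poly_eq by (intro vars_in_intros vars_in_var vars_in_const)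

text \<open>For \<open>w = R + s x_l\<close> with \<open>s = 1\<close> or \<open>s = -1\<close>, the
  sum of \<open>w^2\<close>, the ball polynomial and the squares of the other variables is
  \<open>2 R w\<close>. The factor \<open>1 / (2 R)\<close> makes the two forms add up to 1, as the
  Bernstein expansion requires.\<close>

lemma linear_in_poly_preordering_ball:
  assumes S: "finite S" "l \<in> S" and R: "0 < R" and s: "s * s = 1"
  shows "const (1 / (2 * R)) * (const R + const s * var l) \<in> poly_preordering S (ball_poly S (R\<^sup>2))"
    (is "?u \<in> ?P")
proof -
  let ?w = "const R + const s * var l"
  have "?w * ?w + ball_poly S (R\<^sup>2) + (\<Sum>i\<in>S - {l}. var i * var i)
      = const (2 * R) * ?w"
  proof -
    have "(\<Sum>i\<in>S. var i * var i) = var l * var l + (\<Sum>i\<in>S - {l}. var i * var i)"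
      by (rule sum.remove[OF S])
    moreover have "const s * const s = 1" "const (R\<^sup>2) = const R * const R"
      "const (2 * R) = const R + const R"
      using s by (simp_all add: power2_eq_square flip: const_mult single_add)
    ultimately show ?thesis
      unfolding ball_poly_eq by algebra
  qed
  moreover have "?u = const (1 / (4 * R\<^sup>2)) * (const (2 * R) * ?w)"
    using R by (simp add: mult.assoc[symmetric] power2_eq_square flip: const_mult)
  ultimately have "?u = const (1 / (4 * R\<^sup>2)) *
      (?w * ?w + ball_poly S (R\<^sup>2) + (\<Sum>i\<in>S - {l}. var i * var i))"
    by simp
  also have "\<dots> \<in> ?P"
  proof (rule poly_preordering_mult[OF vars_in_ball_poly poly_preordering_const],
      simp, intro poly_preordering.add poly_preordering_sum)
    show "?w * ?w \<in> ?P"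
      by (intro poly_preordering.square vars_in_intros vars_in_var vars_in_const S)
    show "ball_poly S (R\<^sup>2) \<in> ?P"
      using poly_preordering.square_mult[of S 1 "ball_poly S (R\<^sup>2)"] by simp
    show "var i * var i \<in> ?P" if "i \<in> S - {l}" for i
      using that by (intro poly_preordering.square vars_in_var) simp
  qed
  finally show ?thesis .
qed

section \<open>Bernstein coefficients of powers\<close>

text \<open>\<open>bern a N k\<close> is the \<open>k\<close>-th Bernstein coefficient of \<open>(2 t - 1) ^ a\<close> in degree \<open>N\<close>.
  The junk value \<open>bern a (N - 1) N\<close> occurs with weight \<open>0\<close> only.\<close>
fun bern :: "nat \<Rightarrow> nat \<Rightarrow> nat \<Rightarrow> real" where
  "bern 0 N k = 1"
| "bern (Suc a) N k =
    (real k / real N) * bern a (N - 1) (k - 1) - (real (N - k) / real N) * bern a (N - 1) k"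

text \<open>The absorption identities for binomial coefficients clear the denominators. What remains
  is how coefficients change under multiplication by \<open>u - v\<close>.\<close>

lemma bern_binomial:
  assumes "k \<le> Suc M"
  shows "bern (Suc a) (Suc M) k * real (Suc M choose k) =
    (case k of 0 \<Rightarrow> 0 | Suc j \<Rightarrow> bern a M j * real (M choose j)) - bern a M k * real (M choose k)"
proof -
  have 1: "real (Suc M - k) * real (Suc M choose k) = real (Suc M) * real (M choose k)"
    using binomial_absorb_comp[of "Suc M" k] by (metis diff_Suc_1 of_nat_mult)
  show ?thesis
  proof (cases k)
    case 0
    then show ?thesis by simp
  next
    case (Suc j)
    have 2: "real k * real (Suc M choose k) = real (Suc M) * real (M choose j)"
      using binomial_absorption[of j "Suc M"] Suc by (metis diff_Suc_1 of_nat_mult)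
    have "bern (Suc a) (Suc M) k = (real k * bern a M j - real (Suc M - k) * bern a M k) / real (Suc M)"
      by (simp add: Suc diff_divide_distrib)
    then have "bern (Suc a) (Suc M) k * real (Suc M choose k) =
      (bern a M j * (real k * real (Suc M choose k)) - bern a M k * (real (Suc M - k) * real (Suc M choose k))) / real (Suc M)"
      by (simp add: algebra_simps del: of_nat_Suc binomial_Suc_Suc bern.simps)
    also have "\<dots> = bern a M j * real (M choose j) - bern a M k * real (M choose k)"
      unfolding 1 2 by (simp add: field_simps del: of_nat_Suc)
    finally show ?thesis using Suc by simp
  qed
qed

text \<open>Exponent 0 is the binomial theorem for \<open>u + v = 1\<close>; each further factor
  \<open>u - v\<close> raises exponent and degree by one, with coefficients given by
  \<open>bern_binomial\<close>.\<close>

lemma power_eq_bernstein_sum: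
  fixes u v :: rpoly
  assumes uv: "u + v = 1"
  shows "a \<le> N \<Longrightarrow> (u - v) ^ a =
    (\<Sum>k\<le>N. const (bern a N k * real (N choose k)) * u ^ k * v ^ (N - k))"
proof (induction a arbitrary: N)
  case 0
  have "(u + v) ^ N = (\<Sum>k\<le>N. of_nat (N choose k) * u ^ k * v ^ (N - k))"
    by (rule binomial_ring)
  then show ?case by (simp add: uv)
next
  case (Suc a)
  then obtain M where M: "N = Suc M" "a \<le> M" by (cases N) auto
  define c where "c k = const (bern a M k * real (M choose k))" for k
  \<comment> \<open>The vanishing binomial coefficient allows sums up to \<open>M\<close> to be
    padded to \<open>Suc M\<close>, whatever value \<open>bern\<close> has there.\<close>
  have cM: "c (Suc M) = 0" by (simp add: c_def binomial_eq_0)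
  have "(u - v) ^ Suc a = (u - v) * (\<Sum>k\<le>M. c k * u ^ k * v ^ (M - k))"
    by (simp add: Suc.IH[OF M(2)] c_def)
  also have "\<dots> = (\<Sum>k\<le>M. c k * u ^ Suc k * v ^ (M - k)) - (\<Sum>k\<le>M. c k * u ^ k * v ^ (Suc M - k))"
    by (subst left_diff_distrib, unfold sum_distrib_left, intro arg_cong2[where f="(-)"] sum.cong refl)
      (simp_all add: ac_simps Suc_diff_le)
  also have "(\<Sum>k\<le>M. c k * u ^ Suc k * v ^ (M - k)) =
      (\<Sum>k\<le>Suc M. (case k of 0 \<Rightarrow> 0 | Suc j \<Rightarrow> c j) * u ^ k * v ^ (Suc M - k))"
    by (simp add: sum.atMost_Suc_shift del: sum.atMost_Suc)
  also have "(\<Sum>k\<le>M. c k * u ^ k * v ^ (Suc M - k)) = (\<Sum>k\<le>Suc M. c k * u ^ k * v ^ (Suc M - k))"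
    by (simp add: cM)
  also have "(\<Sum>k\<le>Suc M. (case k of 0 \<Rightarrow> 0 | Suc j \<Rightarrow> c j) * u ^ k * v ^ (Suc M - k)) - \<dots> =
      (\<Sum>k\<le>Suc M. ((case k of 0 \<Rightarrow> 0 | Suc j \<Rightarrow> c j) - c k) * u ^ k * v ^ (Suc M - k))"
    by (simp only: sum_subtractf left_diff_distrib)
  also have "\<dots> = (\<Sum>k\<le>Suc M. const (bern (Suc a) (Suc M) k * real (Suc M choose k)) * u ^ k * v ^ (Suc M - k))"
    by (intro sum.cong refl arg_cong2[where f="(*)"])
      (auto simp only: bern_binomial c_def single_diff atMost_iff split: nat.split, auto)
  finally show ?case using M by simp
qed

text \<open>The bounds are asked for nonzero weights only, so that the out-of-range value in the
  recursion of \<open>bern\<close> needs no estimate.\<close>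

lemma abs_convex_combination_le:
  fixes s t x y B :: real
  assumes "0 \<le> s" "0 \<le> t" "s + t = 1" "s \<noteq> 0 \<Longrightarrow> \<bar>x\<bar> \<le> B" "t \<noteq> 0 \<Longrightarrow> \<bar>y\<bar> \<le> B"
  shows "\<bar>s * x - t * y\<bar> \<le> B"
proof -
  have "\<bar>s * x\<bar> \<le> s * B" "\<bar>t * y\<bar> \<le> t * B"
    using assms by (cases "s = 0"; cases "t = 0"; auto simp: abs_mult intro: mult_left_mono)+
  then have "\<bar>s * x - t * y\<bar> \<le> (s + t) * B" by (simp add: distrib_right)
  then show ?thesis using assms(3) by simp
qed

lemma abs_bern_le: "k \<le> N \<Longrightarrow> \<bar>bern a N k\<bar> \<le> 1"
proof (induction a arbitrary: N k)
  case (Suc a)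
  show ?case
  proof (cases "N = 0")
    case False
    then have "real k / real N + real (N - k) / real N = 1"
      using Suc.prems by (simp add: field_simps of_nat_diff)
    moreover have "\<bar>bern a (N - 1) (k - 1)\<bar> \<le> 1"
      using Suc.prems by (intro Suc.IH) simp
    moreover have "\<bar>bern a (N - 1) k\<bar> \<le> 1" if "real (N - k) / real N \<noteq> 0"
      using Suc.prems that by (intro Suc.IH) auto
    ultimately show ?thesis
      unfolding bern.simps by (intro abs_convex_combination_le) auto
  qed simp
qed simp

text \<open>With \<open>s = k / N\<close> and \<open>t = 1 - s\<close> the power satisfies the same
  recursion exactly, because \<open>s - t = 2 s - 1\<close>. The error comes from the induction
  hypothesis in degree \<open>N - 1\<close>, whose node \<open>k / (N - 1)\<close> or
  \<open>(k - 1) / (N - 1)\<close> differs from \<open>s\<close> by at most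
  \<open>1 / N\<close>.\<close>

lemma bern_approx:
  "\<exists>C\<ge>0. \<forall>N\<ge>1. \<forall>k\<le>N. \<bar>bern a N k - (2 * (real k / real N) - 1) ^ a\<bar> \<le> C / real N"
proof (induction a)
  case 0
  then show ?case by (auto intro: exI[of _ 0])
next
  case (Suc a)
  then obtain C where C: "C \<ge> 0"
    "\<And>N k. N \<ge> 1 \<Longrightarrow> k \<le> N \<Longrightarrow> \<bar>bern a N k - (2 * (real k / real N) - 1) ^ a\<bar> \<le> C / real N"
    by blast
  \<comment> \<open>\<open>2 * C\<close> pays for replacing \<open>1 / (N - 1)\<close> by
    \<open>2 / N\<close>, \<open>2 * a\<close> for moving the node under a power with Lipschitz
    constant \<open>a\<close>, and 2 for the case \<open>N = 1\<close>, where both terms have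
    modulus at most 1.\<close>
  define D where "D = 2 * C + 2 * real a + 2"
  have "\<bar>bern (Suc a) N k - (2 * (real k / real N) - 1) ^ Suc a\<bar> \<le> D / real N"
    if N: "N \<ge> 1" and k: "k \<le> N" for N k
  proof -
    define s where "s = real k / real N"
    define t where "t = real (N - k) / real N"
    have s: "0 \<le> s" "s \<le> 1" "0 \<le> t" "s + t = 1"
      using N k by (auto simp: s_def t_def field_simps of_nat_diff)
    have near: "\<bar>bern a (N - 1) j - (2 * s - 1) ^ a\<bar> \<le> D / real N"
      if j: "j \<le> N - 1" "j = k \<or> Suc j = k" for j
    proof (cases "N = 1")
      case True
      have "\<bar>(2 * s - 1) ^ a\<bar> \<le> 1"
        unfolding power_abs by (rule power_le_one) (use s in auto)
      moreover have "\<bar>bern a (N - 1) j\<bar> \<le> 1" by (rule abs_bern_le[OF j(1)])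
      ultimately show ?thesis using True C(1) by (simp add: D_def)
    next
      case False
      define M where "M = N - 1"
      have M: "M \<ge> 1" "N = Suc M" "j \<le> M" using N False j by (auto simp: M_def)
      define r where "r = real j / real M"
      have r: "0 \<le> r" "r \<le> 1" using M by (auto simp: r_def field_simps)
      have "\<bar>bern a M j - (2 * r - 1) ^ a\<bar> \<le> C / real M"
        unfolding r_def by (rule C(2)[OF M(1,3)])
      also have "\<dots> \<le> 2 * C / real N"
        using M C(1) mult_left_mono[of 1 "real M" C] by (simp add: field_simps)
      finally have 1: "\<bar>bern a M j - (2 * r - 1) ^ a\<bar> \<le> 2 * C / real N" .
      have "\<bar>r - s\<bar> \<le> 1 / real N"
      proof -
        have *: "r - s = (real j * real N - real k * real M) / (real M * real N)"
          using M by (simp add: r_def s_def field_simps)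
        \<comment> \<open>The difference is \<open>j\<close> if \<open>j = k\<close> and
          \<open>j - M\<close> if \<open>Suc j = k\<close>.\<close>
        have "\<bar>real j * real N - real k * real M\<bar> \<le> real M"
          using j(2) M(3) by (auto simp: M(2) algebra_simps)
        then have "\<bar>r - s\<bar> \<le> real M / (real M * real N)"
          unfolding * abs_divide using M by (intro frac_le) auto
        then show ?thesis using M by simp
      qed
      then have "\<bar>(2 * r - 1) - (2 * s - 1)\<bar> \<le> 2 / real N" by (simp add: field_simps abs_le_iff)
      moreover have "\<bar>(2 * r - 1) ^ a - (2 * s - 1) ^ a\<bar> \<le> real a * \<bar>(2 * r - 1) - (2 * s - 1)\<bar>"
        using norm_power_diff[of "2 * r - 1" "2 * s - 1" a] r s by simp
      ultimately have 2: "\<bar>(2 * r - 1) ^ a - (2 * s - 1) ^ a\<bar> \<le> real a * (2 / real N)"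
        by (meson mult_left_mono of_nat_0_le_iff order_trans)
      have "D / real N = 2 * C / real N + real a * (2 / real N) + 2 / real N"
        by (simp add: D_def add_divide_distrib)
      moreover have "0 \<le> 2 / real N" by simp
      ultimately show ?thesis using 1 2 unfolding M_def by linarith
    qed
    have "bern (Suc a) N k - (2 * s - 1) ^ Suc a =
      s * (bern a (N - 1) (k - 1) - (2 * s - 1) ^ a) - t * (bern a (N - 1) k - (2 * s - 1) ^ a)"
    proof -
      define X where "X = (2 * s - 1) ^ a"
      have "2 * s - 1 = s - t" using s by linarith
      then have "(2 * s - 1) ^ Suc a = (s - t) * X" by (simp add: X_def)
      moreover have "bern (Suc a) N k = s * bern a (N - 1) (k - 1) - t * bern a (N - 1) k"
        by (simp add: s_def t_def)
      ultimately show ?thesis unfolding X_def[symmetric] by (simp add: algebra_simps)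
    qed
    also have "\<bar>\<dots>\<bar> \<le> D / real N"
    proof (rule abs_convex_combination_le[OF s(1,3,4)])
      show "\<bar>bern a (N - 1) (k - 1) - (2 * s - 1) ^ a\<bar> \<le> D / real N" if "s \<noteq> 0"
        by (rule near) (use that k in \<open>auto simp: s_def\<close>)
      show "\<bar>bern a (N - 1) k - (2 * s - 1) ^ a\<bar> \<le> D / real N" if "t \<noteq> 0"
        by (rule near) (use that k in \<open>auto simp: t_def\<close>)
    qed
    finally show ?thesis by (simp add: s_def)
  qed
  moreover have "D \<ge> 0" using C(1) by (simp add: D_def)
  ultimately show ?case by blast
qed

section \<open>Putinar's theorem for functionals on truncated sequences\<close>

lemma var_power_bernstein:
  assumes R: "0 < R" and e: "e \<le> N"
  shows "var l ^ e = (\<Sum>k\<le>N. const (R ^ e * bern e N k) *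
    (const (real (N choose k)) * (const (1 / (2 * R)) * (const R + var l)) ^ k *
      (const (1 / (2 * R)) * (const R - var l)) ^ (N - k)))"
proof -
  let ?u = "const (1 / (2 * R)) * (const R + var l)"
  let ?v = "const (1 / (2 * R)) * (const R - var l)"
  have c: "const (1 / (2 * R)) * const R + const (1 / (2 * R)) * const R = 1"
    using R by (simp flip: const_mult single_add)
  then have uv: "?u + ?v = 1" by algebra
  have "const R * (?u - ?v) = (const (1 / (2 * R)) * const R + const (1 / (2 * R)) * const R) * var l"
    by algebra
  then have "var l = const R * (?u - ?v)" using c by simp
  then have "var l ^ e = const R ^ e * (?u - ?v) ^ e"
    by (metis power_mult_distrib)
  also have "\<dots> = (\<Sum>k\<le>N. const R ^ e * (const (bern e N k * real (N choose k)) * ?u ^ k * ?v ^ (N - k)))"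
    unfolding power_eq_bernstein_sum[OF uv e] sum_distrib_left ..
  also have "\<dots> = (\<Sum>k\<le>N. const (R ^ e * bern e N k) * (const (real (N choose k)) * ?u ^ k * ?v ^ (N - k)))"
    unfolding const_mult const_power by (simp add: ac_simps)
  finally show ?thesis .
qed

lemma lookup_le_mdeg: "Poly_Mapping.lookup a l \<le> mdeg a"
  unfolding mdeg_def
  by (cases "l \<in> Poly_Mapping.keys a") (auto simp: member_le_sum in_keys_iff)

text \<open>Expanding every variable in the same Bernstein degree \<open>N\<close> writes
  \<open>f\<close> in products of elements of the preordering. The coefficients differ from the
  values of \<open>f\<close> at grid points of the cube by \<open>O(1 / N)\<close>, and these values
  are at least \<delta>.\<close>

lemma positive_on_cube_in_poly_preordering:
  assumes S: "finite S" and R: "0 < R" and f: "vars_in S f"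
    and pos: "\<And>x. x \<in> cube R \<Longrightarrow> 0 < peval f x"
  shows "f \<in> poly_preordering S (ball_poly S (R\<^sup>2))"
proof -
  let ?P = "poly_preordering S (ball_poly S (R\<^sup>2))"
  let ?lk = Poly_Mapping.lookup
  let ?K = "Poly_Mapping.keys f"
  obtain \<delta> where \<delta>: "\<delta> > 0" "\<And>x. x \<in> cube R \<Longrightarrow> \<delta> \<le> peval f x"
    using compact_pos_lower_bound[OF compact_cube continuous_on_peval pos] by blast
  obtain C where C: "\<And>a. C a \<ge> 0"
    "\<And>a N k. N \<ge> 1 \<Longrightarrow> k \<le> N \<Longrightarrow> \<bar>bern a N k - (2 * (real k / real N) - 1) ^ a\<bar> \<le> C a / real N"
    using bern_approx by metis
  \<comment> \<open>\<open>E / N\<close> will bound the distance between a coefficient and the value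
    at its grid point; \<open>N\<close> is chosen to push it below \<delta> and to accommodate every
    exponent occurring in \<open>f\<close>.\<close>
  define E where "E = (\<Sum>a\<in>?K. \<bar>?lk f a\<bar> * R ^ (\<Sum>l\<in>S. ?lk a l) * (\<Sum>l\<in>S. C (?lk a l)))"
  obtain N0 :: nat where N0: "E / \<delta> < real N0" using reals_Archimedean2 by blast
  define N where "N = max 1 (max N0 (pdeg f))"
  have N1: "N \<ge> 1" and Ndeg: "pdeg f \<le> N" by (auto simp: N_def)
  have "E / \<delta> < real N" using N0 by (simp add: N_def max_def)
  then have EN: "E / real N < \<delta>" using \<delta>(1) N1 by (simp add: field_simps)
  define b where "b l k = const (real (N choose k)) * (const (1 / (2 * R)) * (const R + var l)) ^ k *
      (const (1 / (2 * R)) * (const R - var l)) ^ (N - k)" for l k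
  define \<K> where "\<K> = PiE S (\<lambda>_. {..N})"
  \<comment> \<open>The coefficient of \<open>f\<close> at the tensor product of basis elements
    indexed by \<kappa>.\<close>
  define co where "co \<kappa> = (\<Sum>a\<in>?K. ?lk f a * (\<Prod>l\<in>S. R ^ ?lk a l * bern (?lk a l) N (\<kappa> l)))" for \<kappa>
  have bP: "b l k \<in> ?P" if l: "l \<in> S" for l k
  proof -
    have u: "const (1 / (2 * R)) * (const R + var l) \<in> ?P"
      using linear_in_poly_preordering_ball[OF S l R, of 1] by simp
    have v: "const (1 / (2 * R)) * (const R - var l) \<in> ?P"
      using linear_in_poly_preordering_ball[OF S l R, of "-1"] by (simp add: single_uminus)
    note mult = poly_preordering_mult[OF vars_in_ball_poly]
    note power = poly_preordering_power[OF vars_in_ball_poly]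
    show ?thesis
      unfolding b_def by (rule mult[OF mult[OF poly_preordering_const power[OF u]] power[OF v]]) simp
  qed
  have "f = (\<Sum>a\<in>?K. Poly_Mapping.single a (?lk f a))" by (simp add: rpoly_expansion)
  also have "\<dots> = (\<Sum>a\<in>?K. \<Sum>\<kappa>\<in>\<K>. const (?lk f a * (\<Prod>l\<in>S. R ^ ?lk a l * bern (?lk a l) N (\<kappa> l))) * (\<Prod>l\<in>S. b l (\<kappa> l)))"
  proof (rule sum.cong[OF refl])
    fix a assume a: "a \<in> ?K"
    have "Poly_Mapping.single a (?lk f a) = const (?lk f a) * (\<Prod>l\<in>S. var l ^ ?lk a l)"
      by (rule single_eq_prod_var[OF S]) (use a f in \<open>auto simp: vars_in_def\<close>)
    also have "(\<Prod>l\<in>S. var l ^ ?lk a l) =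
        (\<Prod>l\<in>S. \<Sum>k\<in>{..N}. const (R ^ ?lk a l * bern (?lk a l) N k) * b l k)"
    proof (rule prod.cong[OF refl])
      fix l
      have "?lk a l \<le> N"
        using lookup_le_mdeg[of a l] mdeg_le_pdeg[OF a] Ndeg by linarith
      then show "var l ^ ?lk a l = (\<Sum>k\<in>{..N}. const (R ^ ?lk a l * bern (?lk a l) N k) * b l k)"
        unfolding b_def by (rule var_power_bernstein[OF R])
    qed
    also have "\<dots> = (\<Sum>\<kappa>\<in>\<K>. \<Prod>l\<in>S. const (R ^ ?lk a l * bern (?lk a l) N (\<kappa> l)) * b l (\<kappa> l))"
      unfolding \<K>_def by (rule prod_sum_PiE) (use S in auto)
    finally show "Poly_Mapping.single a (?lk f a) =
        (\<Sum>\<kappa>\<in>\<K>. const (?lk f a * (\<Prod>l\<in>S. R ^ ?lk a l * bern (?lk a l) N (\<kappa> l))) * (\<Prod>l\<in>S. b l (\<kappa> l)))"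
      by (simp only: sum_distrib_left const_mult[of "?lk f a"] const_prod[symmetric] prod.distrib mult.assoc)
  qed
  also have "\<dots> = (\<Sum>\<kappa>\<in>\<K>. const (co \<kappa>) * (\<Prod>l\<in>S. b l (\<kappa> l)))"
    by (subst sum.swap) (simp only: co_def const_sum sum_distrib_right)
  also have "\<dots> \<in> ?P"
  proof (intro poly_preordering_sum poly_preordering_mult[OF vars_in_ball_poly] poly_preordering_const
      poly_preordering_prod[OF vars_in_ball_poly] bP)
    fix \<kappa> assume \<kappa>: "\<kappa> \<in> \<K>"
    \<comment> \<open>The index \<kappa> determines a grid point: \<open>s\<close> holds its
      coordinates scaled to \<open>[-1, 1]\<close>, and \<xi> is the point itself, with 0 outside
      \<open>S\<close>.\<close>
    define s where "s l = 2 * (real (\<kappa> l) / real N) - 1" for l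
    have kl: "\<kappa> l \<le> N" if "l \<in> S" for l using \<kappa> that by (auto simp: \<K>_def)
    have s1: "\<bar>s l\<bar> \<le> 1" if "l \<in> S" for l
      using kl[OF that] N1 by (simp add: s_def abs_le_iff field_simps)
    define \<xi> where "\<xi> l = (if l \<in> S then R * s l else 0)" for l
    have "\<bar>\<xi> l\<bar> \<le> R" for l
      using R s1[of l] mult_left_mono[OF s1, of l R] by (auto simp: \<xi>_def abs_mult)
    then have "\<delta> \<le> peval f \<xi>" by (intro \<delta>(2)) (simp add: cube_def)
    also have "peval f \<xi> = (\<Sum>a\<in>?K. ?lk f a * (\<Prod>l\<in>S. R ^ ?lk a l * s l ^ ?lk a l))"
      unfolding peval_eq_Ly Ly_def
    proof (intro sum.cong refl arg_cong2[where f="(*)"])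
      fix a assume "a \<in> ?K"
      then have "meval \<xi> a = (\<Prod>l\<in>S. \<xi> l ^ ?lk a l)"
        using f by (intro meval_superset[OF S]) (auto simp: vars_in_def)
      then show "meval \<xi> a = (\<Prod>l\<in>S. R ^ ?lk a l * s l ^ ?lk a l)"
        by (simp add: \<xi>_def power_mult_distrib)
    qed
    finally have lower: "\<delta> \<le> (\<Sum>a\<in>?K. ?lk f a * (\<Prod>l\<in>S. R ^ ?lk a l * s l ^ ?lk a l))" .
    have "\<bar>co \<kappa> - (\<Sum>a\<in>?K. ?lk f a * (\<Prod>l\<in>S. R ^ ?lk a l * s l ^ ?lk a l))\<bar> \<le> E / real N"
      unfolding co_def sum_subtractf[symmetric] E_def sum_divide_distrib
    proof (rule order_trans[OF sum_abs], rule sum_mono)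
      fix a assume "a \<in> ?K"
      \<comment> \<open>Replacing factors one at a time costs no more than their differences, as all
        factors have modulus at most 1.\<close>
      have "\<bar>(\<Prod>l\<in>S. bern (?lk a l) N (\<kappa> l)) - (\<Prod>l\<in>S. s l ^ ?lk a l)\<bar>
          \<le> (\<Sum>l\<in>S. \<bar>bern (?lk a l) N (\<kappa> l) - s l ^ ?lk a l\<bar>)"
        using norm_prod_diff[of S "\<lambda>l. bern (?lk a l) N (\<kappa> l)" "\<lambda>l. s l ^ ?lk a l"]
        by (simp add: abs_bern_le kl s1 power_abs power_le_one)
      also have "\<dots> \<le> (\<Sum>l\<in>S. C (?lk a l) / real N)"
        unfolding s_def by (intro sum_mono C(2) N1 kl)
      finally have d: "\<bar>(\<Prod>l\<in>S. bern (?lk a l) N (\<kappa> l)) - (\<Prod>l\<in>S. s l ^ ?lk a l)\<bar>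
          \<le> (\<Sum>l\<in>S. C (?lk a l)) / real N"
        by (simp add: sum_divide_distrib)
      have "\<bar>?lk f a * (\<Prod>l\<in>S. R ^ ?lk a l * bern (?lk a l) N (\<kappa> l)) - ?lk f a * (\<Prod>l\<in>S. R ^ ?lk a l * s l ^ ?lk a l)\<bar>
        = \<bar>?lk f a\<bar> * R ^ (\<Sum>l\<in>S. ?lk a l) * \<bar>(\<Prod>l\<in>S. bern (?lk a l) N (\<kappa> l)) - (\<Prod>l\<in>S. s l ^ ?lk a l)\<bar>"
        unfolding prod.distrib power_sum right_diff_distrib[symmetric] abs_mult
        using R by (simp add: abs_prod prod_nonneg)
      also have "\<dots> \<le> \<bar>?lk f a\<bar> * R ^ (\<Sum>l\<in>S. ?lk a l) * ((\<Sum>l\<in>S. C (?lk a l)) / real N)"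
        by (rule mult_left_mono[OF d]) (use R in simp)
      finally show "\<bar>?lk f a * (\<Prod>l\<in>S. R ^ ?lk a l * bern (?lk a l) N (\<kappa> l)) - ?lk f a * (\<Prod>l\<in>S. R ^ ?lk a l * s l ^ ?lk a l)\<bar>
        \<le> \<bar>?lk f a\<bar> * R ^ (\<Sum>l\<in>S. ?lk a l) * (\<Sum>l\<in>S. C (?lk a l)) / real N"
        by simp
    qed
    then show "0 \<le> co \<kappa>" using lower EN by linarith
  qed
  finally show ?thesis .
qed

section \<open>Functionals that are nonnegative at high order\<close>

definition qm_feasible ::
  "nat set \<Rightarrow> nat set \<Rightarrow> (nat \<Rightarrow> rpoly) \<Rightarrow> nat \<Rightarrow> (monomial \<Rightarrow> real) \<Rightarrow> bool" where
  "qm_feasible S Js g k y \<longleftrightarrow> psd_on (mons S k) (mom y) \<and>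
     (\<forall>j\<in>Js. psd_on (mons S (k - dhalf (g j))) (locm (g j) y))"

text \<open>The dual form of membership in the quadratic module: a representation of
  \<open>f\<close> is replaced by its effect on feasible functionals, with an order
  \<open>k0\<close> uniform in \<open>y\<close>.\<close>

definition eventually_nonneg :: "nat set \<Rightarrow> nat set \<Rightarrow> (nat \<Rightarrow> rpoly) \<Rightarrow> rpoly \<Rightarrow> bool" where
  "eventually_nonneg S Js g f \<longleftrightarrow> (\<exists>k0. \<forall>k\<ge>k0. \<forall>y. qm_feasible S Js g k y \<longrightarrow> 0 \<le> Ly y f)"

lemma eventually_nonneg_add:
  assumes "eventually_nonneg S Js g a" "eventually_nonneg S Js g b"
  shows "eventually_nonneg S Js g (a + b)"
proof -
  obtain k1 k2 where "\<And>k y. k1 \<le> k \<Longrightarrow> qm_feasible S Js g k y \<Longrightarrow> 0 \<le> Ly y a"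
    "\<And>k y. k2 \<le> k \<Longrightarrow> qm_feasible S Js g k y \<Longrightarrow> 0 \<le> Ly y b"
    using assms unfolding eventually_nonneg_def by meson
  then show ?thesis
    unfolding eventually_nonneg_def Ly_add by (intro exI[of _ "max k1 k2"]) (auto intro!: add_nonneg_nonneg)
qed

lemma psd_onD:
  "psd_on A M \<Longrightarrow> 0 \<le> (\<Sum>a\<in>A. \<Sum>b\<in>A. v a * M a b * v b)"
  by (simp add: psd_on_def)

lemma eventually_nonneg_square:
  assumes S: "finite S" and h: "vars_in S h"
  shows "eventually_nonneg S Js g (h * h)"
  unfolding eventually_nonneg_def
proof (intro exI[of _ "pdeg h"] allI impI)
  fix k y assume k: "pdeg h \<le> k" and y: "qm_feasible S Js g k y"
  show "0 \<le> Ly y (h * h)"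
    unfolding Ly_square_mom[OF finite_mons[OF S] keys_in_mons[OF h k]]
    by (rule psd_onD) (use y in \<open>simp add: qm_feasible_def\<close>)
qed

lemma eventually_nonneg_square_mult:
  assumes S: "finite S" and h: "vars_in S h" and j: "j \<in> Js"
  shows "eventually_nonneg S Js g (h * h * g j)"
  unfolding eventually_nonneg_def
proof (intro exI[of _ "pdeg h + dhalf (g j)"] allI impI)
  fix k y assume k: "pdeg h + dhalf (g j) \<le> k" and y: "qm_feasible S Js g k y"
  have k': "pdeg h \<le> k - dhalf (g j)" using k by simp
  show "0 \<le> Ly y (h * h * g j)"
    unfolding Ly_square_locm[OF finite_mons[OF S] keys_in_mons[OF h k']]
    by (rule psd_onD) (use y j in \<open>simp add: qm_feasible_def\<close>)
qed

lemma eventually_nonneg_sum: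
  assumes "finite S" "finite A" "\<And>i. i \<in> A \<Longrightarrow> eventually_nonneg S Js g (f i)"
  shows "eventually_nonneg S Js g (\<Sum>i\<in>A. f i)"
  using assms(2,3)
proof (induction A rule: finite_induct)
  case empty
  then show ?case using eventually_nonneg_square[OF assms(1) vars_in_zero] by simp
qed (simp add: eventually_nonneg_add)

lemma eventually_nonneg_poly_preordering:
  assumes "f \<in> poly_preordering S (g j)" "finite S" "j \<in> Js"
  shows "eventually_nonneg S Js g f"
  using assms(1)
  by induction (auto intro: eventually_nonneg_add eventually_nonneg_square eventually_nonneg_square_mult assms)

section \<open>From positivity on the cube to Putinar's theorem\<close>

text \<open>A polynomial replacement for the penalty \<open>max 0 (- s)\<close>. On
  \<open>[0, 1]\<close> Bernoulli's inequality gives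
  \<open>(1 - s)^K (1 + K s) \<le> (1 - s^2)^K \<le> 1\<close>, so the loss is at most
  \<open>1 / K\<close>; for negative \<open>s\<close> the even power is at least 1.\<close>

lemma power_penalty_bound:
  fixes s :: real
  assumes "s \<le> 1" "K \<ge> 1"
  shows "max 0 (- s) - 1 / real K \<le> - ((1 - s) ^ K * (1 - s) ^ K * s)"
proof (cases "s \<ge> 0")
  case True
  have "(1 - s) ^ K * (1 + real K * s) \<le> (1 - s) ^ K * (1 + s) ^ K"
    using assms True Bernoulli_inequality[of s K] by (intro mult_left_mono) auto
  also have "\<dots> = ((1 - s) * (1 + s)) ^ K" by (simp only: power_mult_distrib)
  also have "\<dots> \<le> 1"
  proof (rule power_le_one)
    have "s * s \<le> 1" using mult_mono[of s 1 s 1] assms True by simp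
    then show "0 \<le> (1 - s) * (1 + s)" "(1 - s) * (1 + s) \<le> 1" by (auto simp: algebra_simps)
  qed
  finally have "(1 - s) ^ K + real K * ((1 - s) ^ K * s) \<le> 1" by (simp add: algebra_simps)
  moreover have "0 \<le> (1 - s) ^ K" using assms by simp
  ultimately have "real K * ((1 - s) ^ K * s) \<le> 1" by linarith
  then have 1: "(1 - s) ^ K * s \<le> 1 / real K" using assms(2) by (simp add: field_simps)
  have "(1 - s) ^ K * ((1 - s) ^ K * s) \<le> 1 * ((1 - s) ^ K * s)"
    using assms True by (intro mult_right_mono power_le_one) auto
  then show ?thesis using 1 True by (simp add: max_def mult.assoc)
next
  case False
  have "1 \<le> (1 - s) ^ K" using False by (intro one_le_power) simp
  then have "1 * 1 \<le> (1 - s) ^ K * (1 - s) ^ K" by (intro mult_mono) auto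
  then have "1 * (- s) \<le> (1 - s) ^ K * (1 - s) ^ K * (- s)" using False by (intro mult_right_mono) auto
  then have "- s \<le> - ((1 - s) ^ K * (1 - s) ^ K * s)" by simp
  moreover have "0 \<le> 1 / real K" by simp
  moreover have "max 0 (- s) = - s" using False by simp
  ultimately show ?thesis by linarith
qed

text \<open>Subtracting suitable square multiples of the \<open>g j\<close> leaves a polynomial
  positive on the whole cube, which lies in the preordering of the ball constraint
  \<open>g k\<close>. Both parts are nonnegative under feasible functionals.\<close>

lemma putinar:
  assumes S: "finite S" and Js: "finite Js" and g: "\<And>j. j \<in> Js \<Longrightarrow> vars_in S (g j)"
    and k: "k \<in> Js" "g k = ball_poly S M" "0 < M" and f: "vars_in S f"
    and pos: "\<And>z. z \<in> pts S \<Longrightarrow> (\<forall>j\<in>Js. 0 \<le> peval (g j) z) \<Longrightarrow> 0 < peval f z"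
  shows "eventually_nonneg S Js g f"
proof -
  define R where "R = sqrt M"
  have R: "0 < R" "R\<^sup>2 = M" using k(3) by (auto simp: R_def)
  define P where "P x = (\<Sum>j\<in>Js. max 0 (- peval (g j) x))" for x
  have "\<exists>c\<ge>0. \<forall>x\<in>cube R. 0 < peval f x + c * P x"
  proof (rule compact_exact_penalty[OF compact_cube continuous_on_peval])
    show "continuous_on (cube R) P"
      unfolding P_def by (intro continuous_intros continuous_on_peval)
    show "0 \<le> P x" for x unfolding P_def by (intro sum_nonneg) simp
    fix x assume "x \<in> cube R" "P x = 0"
    then have "\<forall>j\<in>Js. max 0 (- peval (g j) x) = 0"
      unfolding P_def by (subst (asm) sum_nonneg_eq_0_iff[OF Js]) auto
    then have g0: "\<forall>j\<in>Js. 0 \<le> peval (g j) x" by (auto simp: max_def split: if_splits)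
    let ?z = "merge_pts S x (\<lambda>_. 0)"
    have same: "peval h ?z = peval h x" if "vars_in S h" for h
      by (rule peval_cong[OF that]) (simp add: merge_pts_def)
    have "0 < peval f ?z"
      by (rule pos) (use g0 g same in \<open>auto simp: pts_def merge_pts_def\<close>)
    then show "0 < peval f x" using same[OF f] by simp
  qed
  then obtain c where c: "c \<ge> 0" "\<And>x. x \<in> cube R \<Longrightarrow> 0 < peval f x + c * P x" by blast
  have "continuous_on (cube R) (\<lambda>x. peval f x + c * P x)"
    unfolding P_def by (intro continuous_intros continuous_on_peval)
  then have "\<exists>\<delta>>0. \<forall>x\<in>cube R. \<delta> \<le> peval f x + c * P x"
    by (rule compact_pos_lower_bound[OF compact_cube _ c(2)])
  then obtain \<delta> where \<delta>: "\<delta> > 0" "\<And>x. x \<in> cube R \<Longrightarrow> \<delta> \<le> peval f x + c * P x" by blast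
  have "\<exists>T>0. \<forall>x\<in>cube R. peval (g j) x \<le> T" for j
  proof -
    have "bounded (peval (g j) ` cube R)"
      by (rule compact_imp_bounded[OF compact_continuous_image[OF continuous_on_peval compact_cube]])
    then show ?thesis by (force simp: bounded_pos abs_le_iff)
  qed
  then obtain T where T: "\<And>j. T j > 0" "\<And>j x. x \<in> cube R \<Longrightarrow> peval (g j) x \<le> T j" by metis
  \<comment> \<open>Each constraint loses \<open>c * T j / K\<close> when its penalty becomes
    polynomial; the total must stay below \<delta>.\<close>
  obtain K0 :: nat where K0: "c * (\<Sum>j\<in>Js. T j) / \<delta> < real K0" using reals_Archimedean2 by blast
  define K where "K = max 1 K0"
  have K1: "K \<ge> 1" by (simp add: K_def)
  have "c * (\<Sum>j\<in>Js. T j) / \<delta> < real K" using K0 by (simp add: K_def max_def)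
  then have cK: "c * (\<Sum>j\<in>Js. T j / real K) < \<delta>"
    using \<delta>(1) K1 by (simp add: field_simps flip: sum_divide_distrib)
  \<comment> \<open>Dividing by the upper bound \<open>T j\<close> brings \<open>g j\<close> into
    the range \<open>s \<le> 1\<close> of the penalty bound, and \<open>sqrt c\<close> makes the
    multiplier \<open>c (1 - g_j / T_j)^(2K)\<close> a square.\<close>
  define h where "h j = const (sqrt c) * (1 - const (1 / T j) * g j) ^ K" for j
  have vh: "vars_in S (h j)" if "j \<in> Js" for j
    unfolding h_def by (intro vars_in_intros vars_in_const vars_in_one g that)
  define f' where "f' = f - (\<Sum>j\<in>Js. h j * h j * g j)"
  have "f' \<in> poly_preordering S (ball_poly S (R\<^sup>2))"
  proof (rule positive_on_cube_in_poly_preordering[OF S R(1)])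
    show "vars_in S f'" unfolding f'_def by (intro vars_in_intros f vh g)
    fix x assume x: "x \<in> cube R"
    have "c * (max 0 (- peval (g j) x) - T j / real K) \<le> - peval (h j * h j * g j) x" for j
    proof -
      let ?s = "peval (g j) x / T j"
      have "max 0 (- ?s) - 1 / real K \<le> - ((1 - ?s) ^ K * (1 - ?s) ^ K * ?s)"
        by (rule power_penalty_bound[OF _ K1]) (use T x in simp)
      then have "T j * (max 0 (- ?s) - 1 / real K) \<le> T j * - ((1 - ?s) ^ K * (1 - ?s) ^ K * ?s)"
        using T(1)[of j] by (intro mult_left_mono) auto
      also have "\<dots> = - ((1 - ?s) ^ K * (1 - ?s) ^ K * peval (g j) x)"
        using T(1)[of j] by simp
      also have "T j * (max 0 (- ?s) - 1 / real K) = max 0 (- peval (g j) x) - T j / real K"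
        using T(1)[of j] by (simp add: max_def field_simps)
      finally have "c * (max 0 (- peval (g j) x) - T j / real K) \<le>
          c * - ((1 - ?s) ^ K * (1 - ?s) ^ K * peval (g j) x)"
        by (rule mult_left_mono[OF _ c(1)])
      also have "\<dots> = - (sqrt c * sqrt c * ((1 - ?s) ^ K * (1 - ?s) ^ K * peval (g j) x))"
        using c(1) by simp
      also have "\<dots> = - peval (h j * h j * g j) x"
        by (simp only: h_def peval_mult peval_power peval_diff peval_one peval_single meval_0 mult_1_right)
          (simp add: algebra_simps)
      finally show ?thesis .
    qed
    then have "(\<Sum>j\<in>Js. c * (max 0 (- peval (g j) x) - T j / real K)) \<le> (\<Sum>j\<in>Js. - peval (h j * h j * g j) x)"
      by (rule sum_mono)
    then have "c * P x - c * (\<Sum>j\<in>Js. T j / real K) \<le> - (\<Sum>j\<in>Js. peval (h j * h j * g j) x)"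
      by (simp only: P_def sum_distrib_left[symmetric] sum_subtractf sum_negf right_diff_distrib)
    then show "0 < peval f' x"
      using \<delta>(2)[OF x] cK by (simp only: f'_def peval_diff peval_sum)
  qed
  then have "eventually_nonneg S Js g f'"
    by (intro eventually_nonneg_poly_preordering[where j=k]) (use k R S in auto)
  moreover have "eventually_nonneg S Js g (\<Sum>j\<in>Js. h j * h j * g j)"
    by (intro eventually_nonneg_sum S Js eventually_nonneg_square_mult vh)
  ultimately have "eventually_nonneg S Js g (f' + (\<Sum>j\<in>Js. h j * h j * g j))"
    by (rule eventually_nonneg_add)
  then show ?thesis by (simp add: f'_def)
qed

section \<open>Sign symmetry and truncation\<close>

lemma rdot_add: "rdot n r (a + b) = rdot n r a + rdot n r b"
  by (simp add: rdot_def lookup_add distrib_left sum.distrib)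

text \<open>Parities add, so shifting by an element that is even for every sign flip changes no
  parity.\<close>

lemma Abar_add_iff: "a \<in> Abar n A \<Longrightarrow> a + b \<in> Abar n A \<longleftrightarrow> b \<in> Abar n A"
  by (auto simp: Abar_def rdot_add)

lemma subset_Abar: "A \<subseteq> Abar n A"
  by (auto simp: Abar_def Rset_def)

text \<open>Membership of \<open>a + b\<close> in \<open>Abar n A\<close> is an equivalence relation in \<open>a\<close> and \<open>b\<close>, so the
  Hadamard product keeps the diagonal blocks of the matrix and kills the others.\<close>
lemma psd_on_hadB:
  assumes S: "finite S" and M: "psd_on S M"
  shows "psd_on S (hadB (Abar n A) M)"
  unfolding psd_on_def
proof
  fix v :: "monomial \<Rightarrow> real"
  \<comment> \<open>The sign flips that fix the monomial \<open>a\<close>. These classes index the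
    diagonal blocks.\<close>
  define cl where "cl a = {r \<in> Rset n A. even (rdot n r a)}" for a
  have cl: "a + b \<in> Abar n A \<longleftrightarrow> cl a = cl b" for a b
    by (auto simp: Abar_def cl_def rdot_add set_eq_iff)
  have "(\<Sum>a\<in>S. \<Sum>b\<in>S. v a * hadB (Abar n A) M a b * v b) =
    (\<Sum>a\<in>S. \<Sum>b\<in>S. \<Sum>t\<in>cl ` S. (if cl a = t then v a else 0) * M a b * (if cl b = t then v b else 0))"
  proof (intro sum.cong refl)
    fix a b assume a: "a \<in> S" and b: "b \<in> S"
    have "(\<Sum>t\<in>cl ` S. (if cl a = t then v a else 0) * M a b * (if cl b = t then v b else 0)) =
        (\<Sum>t\<in>cl ` S. if cl a = t then v a * M a b * (if cl b = cl a then v b else 0) else 0)"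
      by (rule sum.cong) auto
    also have "\<dots> = v a * hadB (Abar n A) M a b * v b"
      using S a by (auto simp: sum.delta hadB_def cl)
    finally show "v a * hadB (Abar n A) M a b * v b =
        (\<Sum>t\<in>cl ` S. (if cl a = t then v a else 0) * M a b * (if cl b = t then v b else 0))" ..
  qed
  also have "\<dots> = (\<Sum>t\<in>cl ` S. \<Sum>a\<in>S. \<Sum>b\<in>S. (if cl a = t then v a else 0) * M a b * (if cl b = t then v b else 0))"
    by (simp only: sum.swap[where A=S and B="cl ` S"])
  also have "\<dots> \<ge> 0"
    by (intro sum_nonneg psd_onD[OF M, of "\<lambda>a. if cl a = _ then v a else 0"])
  finally show "0 \<le> (\<Sum>a\<in>S. \<Sum>b\<in>S. v a * hadB (Abar n A) M a b * v b)" .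
qed

text \<open>Test vectors are extended by 0. Allowing \<open>M'\<close> to differ from
  \<open>M\<close> off \<open>S\<close> serves truncated sequences as well as lower orders.\<close>

lemma psd_on_subset:
  assumes T: "finite T" and ST: "S \<subseteq> T" and M: "psd_on T M"
    and eq: "\<And>a b. a \<in> S \<Longrightarrow> b \<in> S \<Longrightarrow> M' a b = M a b"
  shows "psd_on S M'"
  unfolding psd_on_def
proof
  fix v :: "monomial \<Rightarrow> real"
  define w where "w a = (if a \<in> S then v a else 0)" for a
  have "(\<Sum>a\<in>S. \<Sum>b\<in>S. v a * M' a b * v b) = (\<Sum>a\<in>S. \<Sum>b\<in>S. w a * M a b * w b)"
    by (intro sum.cong refl) (simp add: w_def eq)
  also have "\<dots> = (\<Sum>a\<in>S. \<Sum>b\<in>T. w a * M a b * w b)"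
    by (intro sum.cong refl sum.mono_neutral_left) (use T ST in \<open>auto simp: w_def\<close>)
  also have "\<dots> = (\<Sum>a\<in>T. \<Sum>b\<in>T. w a * M a b * w b)"
    by (rule sum.mono_neutral_left) (use T ST in \<open>auto simp: w_def\<close>)
  also have "\<dots> \<ge> 0" by (rule psd_onD[OF M])
  finally show "0 \<le> (\<Sum>a\<in>S. \<Sum>b\<in>S. v a * M' a b * v b)" .
qed

lemma Ly_xmon_mult: "Ly y (xmon a * f) = (\<Sum>b\<in>Poly_Mapping.keys f. Poly_Mapping.lookup f b * y (a + b))"
  by (simp add: Ly_mult xmon_def)

lemma Ly_mult_eq_sum_xmon:
  "Ly y (h * f) = (\<Sum>a\<in>Poly_Mapping.keys h. Poly_Mapping.lookup h a * Ly y (xmon a * f))"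
  unfolding Ly_xmon_mult by (simp add: Ly_mult sum_distrib_left mult.assoc)

text \<open>For \<open>B = Abar n A\<close> this is the average of the sequence over the group of
  sign flips in \<open>Rset n A\<close>: the signs cancel at every index outside
  \<open>B\<close>.\<close>

definition sign_symmetrize :: "monomial set \<Rightarrow> (monomial \<Rightarrow> real) \<Rightarrow> monomial \<Rightarrow> real" where
  "sign_symmetrize B y a = (if a \<in> B then y a else 0)"

text \<open>The same sequences serve: the Hadamard product preserves semidefiniteness, and fewer
  linking equalities are imposed.\<close>

lemma feas_c_imp_feas_cs:
  assumes "\<And>i. i \<in> {1..N} \<Longrightarrow> finite (I i)" and "feas_c N m q g I J k y"
  shows "feas_cs n N m p q g I J k y"
  using assms unfolding feas_c_def feas_cs_def Let_def
  by (auto intro!: psd_on_hadB finite_mons)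

text \<open>All supports lie in \<open>Abar\<close>, so the indices occurring in one localizing
  entry, or in one side of a linking equality, are all kept or all zeroed. Matrices thus become
  their Hadamard products, and linking equalities outside \<open>Abar\<close> read
  \<open>0 = 0\<close>.\<close>

lemma feas_cs_imp_feas_c:
  assumes J: "\<And>i. i \<in> {1..N} \<Longrightarrow> J i \<subseteq> {1..m}"
    and y: "feas_cs n N m p q g I J k y"
  defines "z \<equiv> \<lambda>i. sign_symmetrize (Abar n (Asupp m N p q g)) (y i)"
  shows "feas_c N m q g I J k z" "(\<Sum>i\<in>{1..N}. Ly (z i) (p i)) = (\<Sum>i\<in>{1..N}. Ly (y i) (p i))"
proof -
  define B where "B = Abar n (Asupp m N p q g)"
  have z: "z i a = (if a \<in> B then y i a else 0)" for i a
    by (simp add: z_def sign_symmetrize_def B_def)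
  have B: "a + b \<in> B \<longleftrightarrow> b \<in> B" if "a \<in> B" for a b
    using Abar_add_iff that unfolding B_def by blast
  have supp: "Poly_Mapping.keys (p i) \<subseteq> B" "Poly_Mapping.keys (q i) \<subseteq> B" if "i \<in> {1..N}" for i
    using subset_Abar[of "Asupp m N p q g" n] that unfolding B_def Asupp_def by blast+
  have suppg: "Poly_Mapping.keys (g j) \<subseteq> B" if "j \<in> {1..m}" for j
    using subset_Abar[of "Asupp m N p q g" n] that unfolding B_def Asupp_def by blast
  have Lz: "Ly (z i) f = Ly (y i) f" if "Poly_Mapping.keys f \<subseteq> B" for i f
    by (rule Ly_cong) (use that in \<open>auto simp: z\<close>)
  have mom: "mom (z i) = hadB B (mom (y i))" for i
    by (auto simp: mom_def hadB_def z fun_eq_iff)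
  have locm: "locm (g j) (z i) = hadB B (locm (g j) (y i))" if "j \<in> {1..m}" for i j
  proof (intro ext)
    fix a b
    have "c + (a + b) \<in> B \<longleftrightarrow> a + b \<in> B" if "c \<in> Poly_Mapping.keys (g j)" for c
      using B suppg[OF \<open>j \<in> {1..m}\<close>] that by blast
    then show "locm (g j) (z i) a b = hadB B (locm (g j) (y i)) a b"
      unfolding locm_def hadB_def z by (auto simp: add.assoc intro: sum.cong)
  qed
  have link: "Ly (z i) (xmon a * q i) = (if a \<in> B then Ly (y i) (xmon a * q i) else 0)"
    if "i \<in> {1..N}" for i a
  proof -
    have "a + b \<in> B \<longleftrightarrow> a \<in> B" if "b \<in> Poly_Mapping.keys (q i)" for b
      using B[of b a] supp(2)[OF \<open>i \<in> {1..N}\<close>] that by (auto simp: add.commute)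
    then show ?thesis unfolding Ly_xmon_mult z by (auto intro: sum.cong)
  qed
  show "(\<Sum>i\<in>{1..N}. Ly (z i) (p i)) = (\<Sum>i\<in>{1..N}. Ly (y i) (p i))"
    by (intro sum.cong refl Lz supp)
  show "feas_c N m q g I J k z"
    unfolding feas_c_def
  proof (intro conjI ballI)
    fix i assume i: "i \<in> {1..N}"
    show "\<forall>a. a \<notin> mons (I i) (2 * k) \<longrightarrow> z i a = 0"
      using y i unfolding feas_cs_def Let_def z by auto
    show "psd_on (mons (I i) k) (mom (z i))"
      using y i unfolding feas_cs_def Let_def mom B_def by blast
    show "psd_on (mons (I i) (k - dhalf (g j))) (locm (g j) (z i))" if j: "j \<in> J i" for j
    proof -
      have "j \<in> {1..m}" using J[OF i] j by blast
      then show ?thesis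
        unfolding locm[OF \<open>j \<in> {1..m}\<close>] using y i j unfolding feas_cs_def Let_def B_def by blast
    qed
    show "Ly (z i) (q i) = 1"
      using y i unfolding feas_cs_def Let_def by (simp add: Lz supp)
  next
    fix i j a
    assume i: "i \<in> {1..N - 1}" and j: "j \<in> Uset N I i"
      and a: "a \<in> mons (I i \<inter> I j) (2 * k - max (pdeg (q i)) (pdeg (q j)))"
    have "i \<in> {1..N}" "j \<in> {1..N}" using i j by (auto simp: Uset_def)
    moreover have "Ly (y i) (xmon a * q i) = Ly (y j) (xmon a * q j)" if "a \<in> B"
      using y i j a that unfolding feas_cs_def Let_def B_def by blast
    ultimately show "Ly (z i) (xmon a * q i) = Ly (z j) (xmon a * q j)"
      by (simp add: link)
  qed
qed

text \<open>The feasible sequences differ, but the sets of attained objective values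
  coincide.\<close>

lemma rho_cs_eq_rho_c:
  assumes "\<And>i. i \<in> {1..N} \<Longrightarrow> finite (I i)" "\<And>i. i \<in> {1..N} \<Longrightarrow> J i \<subseteq> {1..m}"
  shows "rho_cs n N m p q g I J k = rho_c N m p q g I J k"
proof -
  have "{ereal (\<Sum>i\<in>{1..N}. Ly (y i) (p i)) | y. feas_cs n N m p q g I J k y} =
      {ereal (\<Sum>i\<in>{1..N}. Ly (y i) (p i)) | y. feas_c N m q g I J k y}"
  proof (intro subset_antisym subsetI)
    fix t assume "t \<in> {ereal (\<Sum>i\<in>{1..N}. Ly (y i) (p i)) | y. feas_cs n N m p q g I J k y}"
    then obtain y where y: "t = ereal (\<Sum>i\<in>{1..N}. Ly (y i) (p i))" "feas_cs n N m p q g I J k y" by blast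
    from feas_cs_imp_feas_c(1)[OF assms(2) y(2)] feas_cs_imp_feas_c(2)[OF assms(2) y(2)]
    show "t \<in> {ereal (\<Sum>i\<in>{1..N}. Ly (y i) (p i)) | y. feas_c N m q g I J k y}"
      unfolding y(1) mem_Collect_eq by (intro exI conjI arg_cong[where f=ereal]) (rule sym, assumption)
  next
    fix t assume "t \<in> {ereal (\<Sum>i\<in>{1..N}. Ly (y i) (p i)) | y. feas_c N m q g I J k y}"
    then show "t \<in> {ereal (\<Sum>i\<in>{1..N}. Ly (y i) (p i)) | y. feas_cs n N m p q g I J k y}"
      using feas_c_imp_feas_cs[where I=I and N=N, OF assms(1)] by blast
  qed
  then show ?thesis unfolding rho_cs_def rho_c_def by simp
qed

section \<open>Truncating sequences to the index set of a relaxation\<close>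

lemma dhalf_le_dmin:
  "i \<in> {1..N} \<Longrightarrow> dhalf (p i) \<le> dmin m N p q g"
  "i \<in> {1..N} \<Longrightarrow> dhalf (q i) \<le> dmin m N p q g"
  "j \<in> {1..m} \<Longrightarrow> dhalf (g j) \<le> dmin m N p q g"
  unfolding dmin_def by (rule Max_ge; blast | simp)+

definition truncate_seq :: "nat set \<Rightarrow> nat \<Rightarrow> (monomial \<Rightarrow> real) \<Rightarrow> monomial \<Rightarrow> real" where
  "truncate_seq S d y a = (if a \<in> mons S d then y a else 0)"

text \<open>\<open>feas_c\<close> demands zeros outside the index set, which point evaluations and
  solutions of higher order violate. From order \<open>dmin\<close> on, objective and constraints
  read only indices inside that set, so cutting off the rest changes nothing.\<close>

lemma feas_c_truncate:
  assumes k: "dmin m N p q g \<le> k"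
    and fin: "\<And>i. i \<in> {1..N} \<Longrightarrow> finite (I i)"
    and J: "\<And>i. i \<in> {1..N} \<Longrightarrow> J i \<subseteq> {1..m}"
    and vpq: "\<And>i. i \<in> {1..N} \<Longrightarrow> vars_in (I i) (p i) \<and> vars_in (I i) (q i)"
    and vg: "\<And>i j. i \<in> {1..N} \<Longrightarrow> j \<in> J i \<Longrightarrow> vars_in (I i) (g j)"
    and psd: "\<And>i. i \<in> {1..N} \<Longrightarrow> psd_on (mons (I i) k) (mom (y i))"
    and psdg: "\<And>i j. i \<in> {1..N} \<Longrightarrow> j \<in> J i \<Longrightarrow> psd_on (mons (I i) (k - dhalf (g j))) (locm (g j) (y i))"
    and one: "\<And>i. i \<in> {1..N} \<Longrightarrow> Ly (y i) (q i) = 1"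
    and link: "\<And>i j a. i \<in> {1..N - 1} \<Longrightarrow> j \<in> Uset N I i \<Longrightarrow>
      a \<in> mons (I i \<inter> I j) (2 * k - max (pdeg (q i)) (pdeg (q j))) \<Longrightarrow>
      Ly (y i) (xmon a * q i) = Ly (y j) (xmon a * q j)"
  defines "z \<equiv> \<lambda>i. truncate_seq (I i) (2 * k) (y i)"
  shows "feas_c N m q g I J k z" "(\<Sum>i\<in>{1..N}. Ly (z i) (p i)) = (\<Sum>i\<in>{1..N}. Ly (y i) (p i))"
proof -
  have z: "z i a = (if a \<in> mons (I i) (2 * k) then y i a else 0)" for i a
    by (simp add: z_def truncate_seq_def)
  have Lz: "Ly (z i) f = Ly (y i) f" if "vars_in (I i) f" "pdeg f \<le> 2 * k" for i f
    by (rule Ly_cong) (use keys_in_mons[OF that] in \<open>auto simp: z\<close>)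
  have deg: "pdeg f \<le> 2 * k" if "dhalf f \<le> dmin m N p q g" for f
    using pdeg_le_dhalf[of f] that k by linarith
  show "(\<Sum>i\<in>{1..N}. Ly (z i) (p i)) = (\<Sum>i\<in>{1..N}. Ly (y i) (p i))"
    by (intro sum.cong refl Lz deg dhalf_le_dmin) (use vpq in auto)
  have shift: "Ly (z i) (xmon a * q i) = Ly (y i) (xmon a * q i)"
    if i: "i \<in> {1..N}" and a: "a \<in> mons (I i) d" and d: "d + pdeg (q i) \<le> 2 * k" for i a d
  proof -
    have "a + b \<in> mons (I i) (2 * k)" if "b \<in> Poly_Mapping.keys (q i)" for b
      using mons_add[OF a, of b "pdeg (q i)"] keys_in_mons[of "I i" "q i" "pdeg (q i)"] vpq[OF i] that
        mons_mono[OF subset_refl d] by blast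
    then show ?thesis unfolding Ly_xmon_mult z by (auto intro: sum.cong)
  qed
  show "feas_c N m q g I J k z"
    unfolding feas_c_def
  proof (intro conjI ballI)
    fix i assume i: "i \<in> {1..N}"
    show "\<forall>a. a \<notin> mons (I i) (2 * k) \<longrightarrow> z i a = 0" by (simp add: z)
    show "psd_on (mons (I i) k) (mom (z i))"
    proof (rule psd_on_subset[OF finite_mons[OF fin[OF i]] subset_refl psd[OF i]])
      show "mom (z i) a b = mom (y i) a b" if "a \<in> mons (I i) k" "b \<in> mons (I i) k" for a b
        using mons_add[OF that] by (simp add: mom_def z mult_2)
    qed
    show "Ly (z i) (q i) = 1"
      using Lz[OF _ deg[OF dhalf_le_dmin(2)[OF i]]] one[OF i] vpq[OF i] by simp
    fix j assume j: "j \<in> J i"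
    let ?M = "mons (I i) (k - dhalf (g j))"
    have jm: "j \<in> {1..m}" using J[OF i] j by blast
    \<comment> \<open>Makes \<open>k - dhalf (g j)\<close> a genuine difference, so that the degrees
      of \<open>c\<close>, \<open>a\<close> and \<open>b\<close> add up to at most
      \<open>2 * k\<close>.\<close>
    have dk: "dhalf (g j) \<le> k" using dhalf_le_dmin(3)[OF jm] k by (rule order_trans)
    show "psd_on ?M (locm (g j) (z i))"
    proof (rule psd_on_subset[OF finite_mons[OF fin[OF i]] subset_refl psdg[OF i j]])
      fix a b assume ab: "a \<in> ?M" "b \<in> ?M"
      have "c + a + b \<in> mons (I i) (2 * k)" if c: "c \<in> Poly_Mapping.keys (g j)" for c
      proof -
        have "c \<in> mons (I i) (2 * dhalf (g j))"
          using keys_in_mons[OF vg[OF i j] pdeg_le_dhalf] c by blast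
        from mons_add[OF mons_add[OF this ab(1)] ab(2)] show ?thesis
          using dk by (simp add: mult_2)
      qed
      then show "locm (g j) (z i) a b = locm (g j) (y i) a b"
        unfolding locm_def z by (auto intro: sum.cong)
    qed
  next
    fix i j a
    assume i: "i \<in> {1..N - 1}" and j: "j \<in> Uset N I i"
      and a: "a \<in> mons (I i \<inter> I j) (2 * k - max (pdeg (q i)) (pdeg (q j)))"
    have ij: "i \<in> {1..N}" "j \<in> {1..N}" using i j by (auto simp: Uset_def)
    let ?d = "2 * k - max (pdeg (q i)) (pdeg (q j))"
    have "pdeg (q i) \<le> 2 * k" "pdeg (q j) \<le> 2 * k"
      by (intro deg dhalf_le_dmin ij)+
    then have "?d + pdeg (q i) \<le> 2 * k" "?d + pdeg (q j) \<le> 2 * k" by auto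
    moreover have "a \<in> mons (I i) ?d" "a \<in> mons (I j) ?d" using a by (auto simp: mons_def)
    ultimately show "Ly (z i) (xmon a * q i) = Ly (z j) (xmon a * q j)"
      using shift[OF ij(1)] shift[OF ij(2)] link[OF i j a] by metis
  qed
qed

section \<open>Convergence\<close>

lemma rho_c_lower:
  "feas_c N m q g I J k y \<Longrightarrow> rho_c N m p q g I J k \<le> ereal (\<Sum>i\<in>{1..N}. Ly (y i) (p i))"
  unfolding rho_c_def by (rule Inf_lower) blast

text \<open>The Dirac moments at \<open>x\<close> divided by \<open>q_i(x)\<close> give matrices of
  rank at most one with a nonnegative factor. The scaling yields the normalisation and makes both
  sides of every linking equality the value of the monomial at \<open>x\<close>.\<close>

lemma rho_c_le_value:
  assumes k: "dmin m N p q g \<le> k"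
    and fin: "\<And>i. i \<in> {1..N} \<Longrightarrow> finite (I i)"
    and J: "\<And>i. i \<in> {1..N} \<Longrightarrow> J i \<subseteq> {1..m}"
    and vpq: "\<And>i. i \<in> {1..N} \<Longrightarrow> vars_in (I i) (p i) \<and> vars_in (I i) (q i)"
    and vg: "\<And>i j. i \<in> {1..N} \<Longrightarrow> j \<in> J i \<Longrightarrow> vars_in (I i) (g j)"
    and x: "\<And>i. i \<in> {1..N} \<Longrightarrow> 0 < peval (q i) x" "\<And>j. j \<in> {1..m} \<Longrightarrow> 0 \<le> peval (g j) x"
  shows "rho_c N m p q g I J k \<le> ereal (\<Sum>i\<in>{1..N}. peval (p i) x / peval (q i) x)"
proof -
  define y where "y i a = meval x a / peval (q i) x" for i a
  have Ly_y: "Ly (y i) f = peval f x / peval (q i) x" for i f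
    by (simp add: Ly_def y_def peval_eq_Ly sum_divide_distrib)
  have sq: "(\<Sum>a\<in>A. \<Sum>b\<in>A. v a * (c * (meval x a * meval x b)) * v b) = c * (\<Sum>a\<in>A. v a * meval x a)\<^sup>2"
    for A c and v :: "monomial \<Rightarrow> real"
    by (simp add: power2_eq_square sum_product sum_distrib_left mult_ac)
  have psd: "psd_on A M" if "0 \<le> c" "\<And>a b. M a b = c * (meval x a * meval x b)" for A c M
    unfolding psd_on_def that(2) sq using that(1) by simp
  have y1: "psd_on (mons (I i) k) (mom (y i))" if i: "i \<in> {1..N}" for i
    by (rule psd[of "1 / peval (q i) x"]) (use x(1)[OF i] in \<open>simp_all add: mom_def y_def meval_add\<close>)
  have y2: "psd_on (mons (I i) (k - dhalf (g j))) (locm (g j) (y i))"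
    if i: "i \<in> {1..N}" and j: "j \<in> J i" for i j
  proof (rule psd[of "peval (g j) x / peval (q i) x"])
    show "0 \<le> peval (g j) x / peval (q i) x"
      using x(1)[OF i] x(2)[of j] J[OF i] j by auto
    show "locm (g j) (y i) a b = peval (g j) x / peval (q i) x * (meval x a * meval x b)" for a b
      by (simp add: locm_def y_def meval_add peval_eq_Ly[of "g j"] Ly_def[of _ "g j"]
          sum_divide_distrib sum_distrib_left sum_distrib_right mult_ac)
  qed
  have y3: "Ly (y i) (q i) = 1" if "i \<in> {1..N}" for i
    using x(1)[OF that] by (simp add: Ly_y)
  have y4: "Ly (y i) (xmon a * q i) = Ly (y j) (xmon a * q j)"
    if "i \<in> {1..N - 1}" "j \<in> Uset N I i" for i j a
  proof -
    have "i \<in> {1..N}" "j \<in> {1..N}" using that by (auto simp: Uset_def)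
    then show ?thesis using x(1)[of i] x(1)[of j] by (simp add: Ly_y)
  qed
  have feas: "feas_c N m q g I J k (\<lambda>i. truncate_seq (I i) (2 * k) (y i))"
    and obj: "(\<Sum>i\<in>{1..N}. Ly (truncate_seq (I i) (2 * k) (y i)) (p i)) = (\<Sum>i\<in>{1..N}. Ly (y i) (p i))"
    by (rule feas_c_truncate[OF k fin J vpq vg y1 y2 y3 y4]; assumption)+
  show ?thesis using rho_c_lower[OF feas, of p] unfolding obj Ly_y .
qed

text \<open>A solution of order \<open>k'\<close>, truncated, is feasible for order
  \<open>k\<close>: its matrices are principal submatrices and its linking equalities a
  subset.\<close>

lemma rho_c_mono:
  assumes k: "dmin m N p q g \<le> k" and kk': "k \<le> k'"
    and fin: "\<And>i. i \<in> {1..N} \<Longrightarrow> finite (I i)"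
    and J: "\<And>i. i \<in> {1..N} \<Longrightarrow> J i \<subseteq> {1..m}"
    and vpq: "\<And>i. i \<in> {1..N} \<Longrightarrow> vars_in (I i) (p i) \<and> vars_in (I i) (q i)"
    and vg: "\<And>i j. i \<in> {1..N} \<Longrightarrow> j \<in> J i \<Longrightarrow> vars_in (I i) (g j)"
  shows "rho_c N m p q g I J k \<le> rho_c N m p q g I J k'"
  unfolding rho_c_def[of N m p q g I J k']
proof (rule Inf_greatest)
  fix t assume "t \<in> {ereal (\<Sum>i\<in>{1..N}. Ly (y i) (p i)) | y. feas_c N m q g I J k' y}"
  then obtain y where t: "t = ereal (\<Sum>i\<in>{1..N}. Ly (y i) (p i))" and y: "feas_c N m q g I J k' y"
    by blast
  have y1: "psd_on (mons (I i) k) (mom (y i))" if i: "i \<in> {1..N}" for i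
    by (rule psd_on_subset[OF finite_mons[OF fin[OF i]] mons_mono[OF subset_refl kk']])
      (use y i in \<open>auto simp: feas_c_def\<close>)
  have y2: "psd_on (mons (I i) (k - dhalf (g j))) (locm (g j) (y i))"
    if i: "i \<in> {1..N}" and j: "j \<in> J i" for i j
    by (rule psd_on_subset[OF finite_mons[OF fin[OF i]] mons_mono[OF subset_refl diff_le_mono[OF kk']]])
      (use y i j in \<open>auto simp: feas_c_def\<close>)
  have y3: "Ly (y i) (q i) = 1" if "i \<in> {1..N}" for i
    using y that by (simp add: feas_c_def)
  have y4: "Ly (y i) (xmon a * q i) = Ly (y j) (xmon a * q j)"
    if "i \<in> {1..N - 1}" "j \<in> Uset N I i"
      "a \<in> mons (I i \<inter> I j) (2 * k - max (pdeg (q i)) (pdeg (q j)))" for i j a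
  proof -
    have "2 * k - max (pdeg (q i)) (pdeg (q j)) \<le> 2 * k' - max (pdeg (q i)) (pdeg (q j))"
      using kk' by (intro diff_le_mono) simp
    then have "a \<in> mons (I i \<inter> I j) (2 * k' - max (pdeg (q i)) (pdeg (q j)))"
      using that(3) mons_mono[OF subset_refl] by blast
    then show ?thesis using y that(1,2) unfolding feas_c_def by blast
  qed
  have feas: "feas_c N m q g I J k (\<lambda>i. truncate_seq (I i) (2 * k) (y i))"
    and obj: "(\<Sum>i\<in>{1..N}. Ly (truncate_seq (I i) (2 * k) (y i)) (p i)) = (\<Sum>i\<in>{1..N}. Ly (y i) (p i))"
    by (rule feas_c_truncate[OF k fin J vpq vg y1 y2 y3 y4]; assumption)+
  show "rho_c N m p q g I J k \<le> t" using rho_c_lower[OF feas, of p] unfolding obj t .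
qed

section \<open>Lower bound\<close>

lemma linked_feas_c:
  assumes y: "feas_c N m q g I J k y" and k: "D + (\<Sum>i\<in>{1..N}. pdeg (q i)) \<le> k"
  shows "linked N I D (\<lambda>i h. Ly (y i) (h * q i))"
  unfolding linked_def
proof (intro conjI ballI allI impI)
  show "Ly (y i) ((a + b) * q i) = Ly (y i) (a * q i) + Ly (y i) (b * q i)" for i a b
    by (simp add: distrib_right Ly_add)
  fix i j h assume i: "i \<in> {1..N}" and j: "j \<in> {1..<i}" and h: "vars_in (I i \<inter> I j) h" "pdeg h \<le> D"
  have "Ly (y j) (xmon a * q j) = Ly (y i) (xmon a * q i)" if a: "a \<in> Poly_Mapping.keys h" for a
  \<comment> \<open>Disjoint cliques carry no linking equality, but then only constants are shared,
    and these are matched by the normalisations.\<close>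
  proof (cases "I j \<inter> I i = {}")
    case True
    have "Poly_Mapping.keys a \<subseteq> I j \<inter> I i" using h(1) a by (auto simp: vars_in_def)
    then have "a = 0" using True by simp
    then have "xmon a = 1" by (simp add: xmon_def)
    then show ?thesis using y i j by (simp add: feas_c_def)
  next
    case False
    have "pdeg (q i) \<le> (\<Sum>i\<in>{1..N}. pdeg (q i))" "pdeg (q j) \<le> (\<Sum>i\<in>{1..N}. pdeg (q i))"
      using i j by (auto intro!: member_le_sum)
    then have "D \<le> 2 * k - max (pdeg (q j)) (pdeg (q i))" using k by simp
    then have "a \<in> mons (I j \<inter> I i) (2 * k - max (pdeg (q j)) (pdeg (q i)))"
      using keys_in_mons[OF h(1) order_trans[OF h(2)]] a by (auto simp: Int_commute)
    moreover have "j \<in> {1..N - 1}" "i \<in> Uset N I j" using i j False by (auto simp: Uset_def)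
    ultimately show ?thesis using y unfolding feas_c_def by blast
  qed
  then show "Ly (y i) (h * q i) = Ly (y j) (h * q j)"
    unfolding Ly_mult_eq_sum_xmon[of _ h] by (intro sum.cong) auto
qed

text \<open>Assuming a strict bound \<open>c\<close> at each feasible point, instead of speaking of
  the infimum, also covers an empty feasible set, where \<open>c\<close> is arbitrary.\<close>

lemma eventually_le_rho_c:
  assumes N: "0 < N" and Isub: "\<And>i. i \<in> {1..N} \<Longrightarrow> I i \<subseteq> {1..n}"
    and Jcover: "(\<Union>i\<in>{1..N}. J i) = {1..m}"
    and vpq: "\<And>i. i \<in> {1..N} \<Longrightarrow> vars_in (I i) (p i) \<and> vars_in (I i) (q i)"
    and vg: "\<And>i j. i \<in> {1..N} \<Longrightarrow> j \<in> J i \<Longrightarrow> vars_in (I i) (g j)"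
    and ball: "\<And>i. i \<in> {1..N} \<Longrightarrow> \<exists>k\<in>J i. \<exists>M>0. g k = ball_poly (I i) M"
    and rip: "\<And>i. i \<in> {2..N} \<Longrightarrow> \<exists>k\<in>{1..<i}. I i \<inter> (\<Union>j\<in>{1..<i}. I j) \<subseteq> I k"
    and qpos: "\<And>i z. i \<in> {1..N} \<Longrightarrow> z \<in> pts (I i) \<Longrightarrow> (\<forall>j\<in>J i. 0 \<le> peval (g j) z) \<Longrightarrow> 0 < peval (q i) z"
    and c: "\<And>x. x \<in> pts {1..n} \<Longrightarrow> \<forall>j\<in>{1..m}. 0 \<le> peval (g j) x \<Longrightarrow>
      c < (\<Sum>i\<in>{1..N}. peval (p i) x / peval (q i) x)"
  shows "\<exists>k0. \<forall>k\<ge>k0. ereal c \<le> rho_c N m p q g I J k"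
proof -
  have fin: "finite (I i)" if "i \<in> {1..N}" for i using Isub[OF that] finite_subset by blast
  have finJ: "finite (J i)" if "i \<in> {1..N}" for i
    using Jcover that finite_subset[of "J i" "{1..m}"] by blast
  obtain kb M where ball: "\<And>i. i \<in> {1..N} \<Longrightarrow> kb i \<in> J i \<and> 0 < M i \<and> g (kb i) = ball_poly (I i) (M i)"
    using ball by metis
  \<comment> \<open>The sum dominates every single radius, so one cube contains the local feasible
    sets of all cliques.\<close>
  define R where "R = (\<Sum>i\<in>{1..N}. sqrt (M i))"
  have R0: "0 \<le> R" unfolding R_def using ball by (intro sum_nonneg) (simp add: order_less_imp_le)
  \<comment> \<open>A cylinder in the cube over the local feasible set: coordinates outside
    \<open>I i\<close> stay free, which keeps \<open>Q i\<close> a closed part of the compact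
    cube.\<close>
  define Q where "Q i = {x \<in> cube R. \<forall>j\<in>J i. 0 \<le> peval (g j) x}" for i
  have Q_local: "z \<in> Q i" if i: "i \<in> {1..N}" and z: "z \<in> pts (I i)" "\<forall>j\<in>J i. 0 \<le> peval (g j) z" for i z
  proof -
    have "\<bar>z l\<bar> \<le> R" for l
    proof (cases "l \<in> I i")
      case True
      have "0 \<le> peval (g (kb i)) z" using ball[OF i] z(2) by blast
      then have "(\<Sum>l\<in>I i. z l * z l) \<le> M i" using ball[OF i] by (simp add: ball_poly_eq)
      moreover have "z l * z l \<le> (\<Sum>l\<in>I i. z l * z l)"
        using True fin[OF i] by (intro member_le_sum) auto
      ultimately have "\<bar>z l\<bar> \<le> sqrt (M i)" by (intro real_le_rsqrt) (simp add: power2_eq_square)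
      also have "\<dots> \<le> R"
        unfolding R_def using i ball by (intro member_le_sum) (auto simp: order_less_imp_le)
      finally show ?thesis .
    next
      case False
      then show ?thesis using z(1) R0 by (simp add: pts_def)
    qed
    then show ?thesis using z(2) by (simp add: Q_def cube_def)
  qed
  have "\<exists>e>0. \<forall>x\<in>Q i. e \<le> peval (q i) x" if i: "i \<in> {1..N}" for i
  proof (rule compact_pos_lower_bound[OF _ continuous_on_peval])
    have "Q i = cube R \<inter> (\<Inter>j\<in>J i. {x. 0 \<le> peval (g j) x})" by (auto simp: Q_def)
    moreover have "closed (\<Inter>j\<in>J i. {x. 0 \<le> peval (g j) x})"
      by (intro closed_INT ballI closed_Collect_le continuous_on_const continuous_on_peval)
    ultimately show "compact (Q i)" using compact_Int_closed[OF compact_cube] by simp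
    fix x assume x: "x \<in> Q i"
    let ?z = "merge_pts (I i) x (\<lambda>_. 0)"
    have same: "peval h ?z = peval h x" if "vars_in (I i) h" for h
      by (rule peval_cong[OF that]) (simp add: merge_pts_def)
    have "0 < peval (q i) ?z"
      by (rule qpos[OF i]) (use x same vg[OF i] in \<open>auto simp: pts_def merge_pts_def Q_def\<close>)
    then show "0 < peval (q i) x" using same vpq[OF i] by simp
  qed
  then obtain e where e: "\<And>i. i \<in> {1..N} \<Longrightarrow> 0 < e i" "\<And>i x. i \<in> {1..N} \<Longrightarrow> x \<in> Q i \<Longrightarrow> e i \<le> peval (q i) x"
    by metis
  \<comment> \<open>Clamping the denominator at the minimum \<open>e i\<close> extends
    \<open>p_i / q_i\<close> continuously to the whole cube without changing it on
    \<open>Q i\<close>.\<close>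
  define r where "r i x = peval (p i) x / max (peval (q i) x) (e i)" for i x
  define v where "v i x = (\<Sum>j\<in>J i. max 0 (- peval (g j) x))" for i x
  have rQ: "r i x = peval (p i) x / peval (q i) x" if "i \<in> {1..N}" "x \<in> Q i" for i x
    using e(2)[OF that] by (simp add: r_def max_def)
  have v0: "0 \<le> v i x" for i x unfolding v_def by (intro sum_nonneg) simp
  have contr: "continuous_on (cube R) (r i)" if "i \<in> {1..N}" for i
    unfolding r_def using e(1)[OF that]
    by (intro continuous_intros continuous_on_peval) (simp add: max_def)
  have contv: "continuous_on (cube R) (v i)" for i
    unfolding v_def by (intro continuous_intros continuous_on_peval)
  have "\<exists>t\<ge>0. \<forall>x\<in>cube R. 0 < ((\<Sum>i\<in>{1..N}. r i x) - c) + t * (\<Sum>i\<in>{1..N}. v i x)"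
  proof (rule compact_exact_penalty[OF compact_cube])
    show "continuous_on (cube R) (\<lambda>x. (\<Sum>i\<in>{1..N}. r i x) - c)"
      by (intro continuous_intros contr)
    show "continuous_on (cube R) (\<lambda>x. \<Sum>i\<in>{1..N}. v i x)"
      by (intro continuous_intros contv)
    show "0 \<le> (\<Sum>i\<in>{1..N}. v i x)" for x by (intro sum_nonneg v0)
    fix x assume x: "x \<in> cube R" and "(\<Sum>i\<in>{1..N}. v i x) = 0"
    then have vx: "v i x = 0" if "i \<in> {1..N}" for i
      using sum_nonneg_eq_0_iff[of "{1..N}" "\<lambda>i. v i x"] v0 that by simp
    have g0: "0 \<le> peval (g j) x" if i: "i \<in> {1..N}" and j: "j \<in> J i" for i j
    proof -
      have "max 0 (- peval (g j) x) = 0"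
        using vx[OF i] sum_nonneg_eq_0_iff[OF finJ[OF i], of "\<lambda>j. max 0 (- peval (g j) x)"] j
        unfolding v_def by simp
      then show ?thesis by (simp add: max_def split: if_splits)
    qed
    let ?z = "merge_pts {1..n} x (\<lambda>_. 0)"
    have same: "peval h ?z = peval h x" if "i \<in> {1..N}" "vars_in (I i) h" for i h
      by (rule peval_cong[OF vars_in_mono[OF that(2) Isub[OF that(1)]]]) (simp add: merge_pts_def)
    have "0 \<le> peval (g j) ?z" if j: "j \<in> {1..m}" for j
    proof -
      obtain i where i: "i \<in> {1..N}" "j \<in> J i" using j Jcover by blast
      show ?thesis using g0[OF i] same[OF i(1) vg[OF i]] by simp
    qed
    then have "c < (\<Sum>i\<in>{1..N}. peval (p i) ?z / peval (q i) ?z)"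
      by (intro c) (auto simp: pts_def merge_pts_def)
    also have "\<dots> = (\<Sum>i\<in>{1..N}. r i x)"
    proof (rule sum.cong[OF refl])
      fix i assume i: "i \<in> {1..N}"
      have "x \<in> Q i" using x g0[OF i] by (simp add: Q_def)
      then show "peval (p i) ?z / peval (q i) ?z = r i x"
        using same[OF i] vpq[OF i] rQ[OF i] by simp
    qed
    finally show "0 < (\<Sum>i\<in>{1..N}. r i x) - c" by simp
  qed
  then obtain t where t: "t \<ge> 0"
    "\<And>x. x \<in> cube R \<Longrightarrow> 0 < ((\<Sum>i\<in>{1..N}. r i x) - c) + t * (\<Sum>i\<in>{1..N}. v i x)" by blast
  \<comment> \<open>Penalty and constant are distributed over the cliques, so that each
    \<open>F i\<close> depends only on the variables \<open>I i\<close> while the sum stays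
    positive.\<close>
  define F where "F i x = r i x + t * v i x - c / real N" for i x
  have "\<exists>H D. (\<forall>i\<in>{1..N}. vars_in (I i) (H i)) \<and>
           (\<forall>i\<in>{1..N}. \<forall>x\<in>cube R. 0 < F i x + peval (H i) x) \<and>
           (\<forall>L. linked N I D L \<longrightarrow> (\<Sum>i\<in>{1..N}. L i (H i)) = 0)"
  proof (rule sparse_decomposition[OF R0 _ _ _ rip])
    show "1 \<le> N" using N by simp
    show "continuous_on (cube R) (F i)" if "i \<in> {1..N}" for i
      unfolding F_def by (intro continuous_intros contr contv that)
    show "depends_on (I i) (F i)" if i: "i \<in> {1..N}" for i
      unfolding depends_on_def
    proof (intro allI impI)
      fix x z :: "nat \<Rightarrow> real" assume "\<forall>l\<in>I i. x l = z l"
      then have same: "peval h x = peval h z" if "vars_in (I i) h" for h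
        using peval_cong[OF that] by blast
      then have "v i x = v i z" unfolding v_def using vg[OF i] by (intro sum.cong) auto
      then show "F i x = F i z" using same vpq[OF i] by (simp add: F_def r_def)
    qed
    show "0 < (\<Sum>i\<in>{1..N}. F i x)" if "x \<in> cube R" for x
      using t(2)[OF that] N by (simp add: F_def sum.distrib sum_subtractf sum_distrib_left)
  qed
  then obtain H D where H: "\<And>i. i \<in> {1..N} \<Longrightarrow> vars_in (I i) (H i)"
      "\<And>i x. i \<in> {1..N} \<Longrightarrow> x \<in> cube R \<Longrightarrow> 0 < F i x + peval (H i) x"
      "\<And>L. linked N I D L \<Longrightarrow> (\<Sum>i\<in>{1..N}. L i (H i)) = 0"
    by blast
  \<comment> \<open>On the local feasible set the penalty \<open>v i\<close> vanishes, so
    \<open>f i\<close> equals \<open>q_i (F i + H_i)\<close> there and is positive.\<close>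
  define f where "f i = p i + H i * q i - const (c / real N) * q i" for i
  have "eventually_nonneg (I i) (J i) g (f i)" if i: "i \<in> {1..N}" for i
  proof (rule putinar[OF fin[OF i] finJ[OF i] vg[OF i]])
    show "kb i \<in> J i" "g (kb i) = ball_poly (I i) (M i)" "0 < M i" using ball[OF i] by auto
    show "vars_in (I i) (f i)"
      unfolding f_def using vpq[OF i] H(1)[OF i] by (intro vars_in_intros vars_in_const) auto
    fix z assume z: "z \<in> pts (I i)" "\<forall>j\<in>J i. 0 \<le> peval (g j) z"
    have zQ: "z \<in> Q i" by (rule Q_local[OF i z])
    have q0: "0 < peval (q i) z" using e(1)[OF i] e(2)[OF i zQ] by linarith
    have "v i z = 0" unfolding v_def using z(2) by (intro sum.neutral) auto
    then have "0 < peval (p i) z / peval (q i) z - c / real N + peval (H i) z"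
      using H(2)[OF i, of z] zQ rQ[OF i zQ] by (simp add: F_def Q_def)
    then have "0 < peval (q i) z * (peval (p i) z / peval (q i) z - c / real N + peval (H i) z)"
      using q0 by simp
    also have "\<dots> = peval (f i) z"
      using q0 by (simp add: f_def algebra_simps)
    finally show "0 < peval (f i) z" .
  qed
  then obtain k0 where k0: "\<And>i k y. i \<in> {1..N} \<Longrightarrow> k0 i \<le> k \<Longrightarrow> qm_feasible (I i) (J i) g k y \<Longrightarrow> 0 \<le> Ly y (f i)"
    unfolding eventually_nonneg_def by metis
  \<comment> \<open>The first two summands make the linking reach degree \<open>D\<close>; the last
    dominates all Putinar orders \<open>k0 i\<close> at once.\<close>
  define k1 where "k1 = D + (\<Sum>i\<in>{1..N}. pdeg (q i)) + (\<Sum>i\<in>{1..N}. k0 i)"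
  have "c \<le> (\<Sum>i\<in>{1..N}. Ly (y i) (p i))" if k: "k1 \<le> k" and y: "feas_c N m q g I J k y" for k y
  proof -
    have "D + (\<Sum>i\<in>{1..N}. pdeg (q i)) \<le> k" using k by (simp add: k1_def)
    then have H0: "(\<Sum>i\<in>{1..N}. Ly (y i) (H i * q i)) = 0"
      using H(3)[OF linked_feas_c[OF y]] by blast
    have "0 \<le> (\<Sum>i\<in>{1..N}. Ly (y i) (f i))"
    proof (rule sum_nonneg)
      fix i assume i: "i \<in> {1..N}"
      have "k0 i \<le> (\<Sum>i\<in>{1..N}. k0 i)" using i by (intro member_le_sum) auto
      then have "k0 i \<le> k" using k by (simp add: k1_def)
      moreover have "qm_feasible (I i) (J i) g k (y i)"
        using y i by (simp add: feas_c_def qm_feasible_def)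
      ultimately show "0 \<le> Ly (y i) (f i)" using k0[OF i] by blast
    qed
    also have "(\<Sum>i\<in>{1..N}. Ly (y i) (f i)) = (\<Sum>i\<in>{1..N}. Ly (y i) (p i) + Ly (y i) (H i * q i) - c / real N)"
    proof (rule sum.cong[OF refl])
      fix i assume i: "i \<in> {1..N}"
      have "Ly (y i) (q i) = 1" using y i by (simp add: feas_c_def)
      moreover have "Ly (y i) (const d * q i) = d * Ly (y i) (q i)" for d
        by (cases "d = 0") (simp_all add: Ly_mult Ly_def[of _ "q i"] sum_distrib_left mult.assoc)
      ultimately show "Ly (y i) (f i) = Ly (y i) (p i) + Ly (y i) (H i * q i) - c / real N"
        by (simp add: f_def Ly_add Ly_diff)
    qed
    also have "\<dots> = (\<Sum>i\<in>{1..N}. Ly (y i) (p i)) - c"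
      using N H0 by (simp add: sum.distrib sum_subtractf)
    finally show ?thesis by simp
  qed
  then have "\<forall>k\<ge>k1. ereal c \<le> rho_c N m p q g I J k"
    unfolding rho_c_def by (auto intro!: Inf_greatest)
  then show ?thesis by blast
qed

theorem theorem4p15:
  fixes n m N :: nat
    and p q :: "nat \<Rightarrow> rpoly" and g :: "nat \<Rightarrow> rpoly"
    and I J :: "nat \<Rightarrow> nat set"
  defines "K \<equiv> {x \<in> pts {1..n}. \<forall>j\<in>{1..m}. 0 \<le> peval (g j) x}"
  defines "\<rho> \<equiv> Inf ((\<lambda>x. ereal (\<Sum>i\<in>{1..N}. peval (p i) x / peval (q i) x)) ` K)"
  assumes "0 < n" and "0 < m" and "0 < N"
    and polys: "\<forall>i\<in>{1..N}. vars_in {1..n} (p i) \<and> vars_in {1..n} (q i)"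
               "\<forall>j\<in>{1..m}. vars_in {1..n} (g j)"
    and Kcompact: "compact K"
    and qpos: "\<forall>i\<in>{1..N}. \<forall>x\<in>K. 0 < peval (q i) x"
    and Isub: "\<forall>i\<in>{1..N}. I i \<subseteq> {1..n}" and Jsub: "\<forall>i\<in>{1..N}. J i \<subseteq> {1..m}"
    and Icover: "(\<Union>i\<in>{1..N}. I i) = {1..n}" and Jcover: "(\<Union>i\<in>{1..N}. J i) = {1..m}"
    and cond_i: "\<forall>i\<in>{1..N}. vars_in (I i) (p i) \<and> vars_in (I i) (q i)"
    and cond_ii: "\<forall>i\<in>{1..N}. \<forall>j\<in>J i. vars_in (I i) (g j)"
    and cond_iii: "\<forall>i\<in>{1..N}. \<exists>k\<in>J i. \<exists>M>0.
                     g k = Poly_Mapping.single 0 M - (\<Sum>l\<in>I i. Poly_Mapping.single (Poly_Mapping.single l 2) 1)"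
    and cond_iv: "\<forall>i\<in>{2..N}. \<exists>k\<in>{1..<i}. I i \<inter> (\<Union>j\<in>{1..<i}. I j) \<subseteq> I k"
    and qpos_loc: "\<forall>i\<in>{1..N}. \<forall>z\<in>pts (I i). (\<forall>j\<in>J i. 0 \<le> peval (g j) z) \<longrightarrow> 0 < peval (q i) z"
  shows "(\<forall>k\<ge>dmin m N p q g. rho_cs n N m p q g I J k = rho_c N m p q g I J k)
       \<and> (\<forall>k k'. dmin m N p q g \<le> k \<longrightarrow> k \<le> k' \<longrightarrow> rho_cs n N m p q g I J k \<le> rho_cs n N m p q g I J k')
       \<and> (\<lambda>k. rho_cs n N m p q g I J k) \<longlonglongrightarrow> \<rho>"
proof -
  have fin: "finite (I i)" if "i \<in> {1..N}" for i
    using Isub that finite_subset by blast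
  have J: "J i \<subseteq> {1..m}" if "i \<in> {1..N}" for i using Jsub that by blast
  have vpq: "vars_in (I i) (p i) \<and> vars_in (I i) (q i)" if "i \<in> {1..N}" for i
    using cond_i that by blast
  have vg: "vars_in (I i) (g j)" if "i \<in> {1..N}" "j \<in> J i" for i j
    using cond_ii that by blast
  have eq: "rho_cs n N m p q g I J k = rho_c N m p q g I J k" for k
    by (rule rho_cs_eq_rho_c[OF fin J])
  have mono: "rho_c N m p q g I J k \<le> rho_c N m p q g I J k'"
    if "dmin m N p q g \<le> k" "k \<le> k'" for k k'
    by (rule rho_c_mono[OF that fin J vpq vg])
  have upper: "rho_c N m p q g I J k \<le> \<rho>" if k: "dmin m N p q g \<le> k" for k
    unfolding \<rho>_def
  proof (rule INF_greatest)
    fix x assume "x \<in> K"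
    then show "rho_c N m p q g I J k \<le> ereal (\<Sum>i\<in>{1..N}. peval (p i) x / peval (q i) x)"
      using qpos by (intro rho_c_le_value[OF k fin J vpq vg]) (auto simp: K_def)
  qed
  have lower: "\<exists>k0. \<forall>k\<ge>k0. ereal c \<le> rho_c N m p q g I J k" if "ereal c < \<rho>" for c
  proof (rule eventually_le_rho_c[OF \<open>0 < N\<close> _ Jcover vpq vg])
    show "I i \<subseteq> {1..n}" if "i \<in> {1..N}" for i using Isub that by blast
    show "\<exists>k\<in>J i. \<exists>M>0. g k = ball_poly (I i) M" if "i \<in> {1..N}" for i
      using cond_iii that unfolding ball_poly_def by blast
    show "\<exists>k\<in>{1..<i}. I i \<inter> (\<Union>j\<in>{1..<i}. I j) \<subseteq> I k" if "i \<in> {2..N}" for i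
      using cond_iv that by blast
    show "0 < peval (q i) z" if "i \<in> {1..N}" "z \<in> pts (I i)" "\<forall>j\<in>J i. 0 \<le> peval (g j) z" for i z
      using qpos_loc that by blast
    fix x assume "x \<in> pts {1..n}" "\<forall>j\<in>{1..m}. 0 \<le> peval (g j) x"
    then have "x \<in> K" by (simp add: K_def)
    then have "\<rho> \<le> ereal (\<Sum>i\<in>{1..N}. peval (p i) x / peval (q i) x)"
      unfolding \<rho>_def by (rule INF_lower)
    with that show "c < (\<Sum>i\<in>{1..N}. peval (p i) x / peval (q i) x)"
      by (metis less_ereal.simps(1) less_le_trans)
  qed
  have "(\<lambda>k. rho_c N m p q g I J k) \<longlonglongrightarrow> \<rho>"
  proof (rule order_tendstoI)
    fix a assume "a < \<rho>"
    \<comment> \<open>A real number strictly between is available even if \<open>a\<close> or \<rho>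
      is infinite.\<close>
    then obtain c where c: "a < ereal c" "ereal c < \<rho>" using ereal_dense2 by blast
    obtain k0 where "\<And>k. k \<ge> k0 \<Longrightarrow> ereal c \<le> rho_c N m p q g I J k" using lower[OF c(2)] by blast
    then show "\<forall>\<^sub>F k in sequentially. a < rho_c N m p q g I J k"
      using c(1) less_le_trans unfolding eventually_sequentially by blast
  next
    fix a assume "\<rho> < a"
    then show "\<forall>\<^sub>F k in sequentially. rho_c N m p q g I J k < a"
      using upper le_less_trans unfolding eventually_sequentially by blast
  qed
  then show ?thesis using mono by (simp add: eq)
qed

end
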